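(* Let $\mathcal{A}^w_1,\dots,\mathcal{A}^w_n$ be finite weighted labelled transition systems, $\mathbf{A}^w=\mathcal{A}^w_1\parallel_w\cdots\parallel_w\mathcal{A}^w_n$, with interface $\mathcal{A}^w_i$. Every run of Algorithm 2 (applied to the underlying unweighted composition, for every choice of the order of added events) terminates and returns a weighted branching process $\mathcal{N}^w$ such that the folding $\mathcal{S}^w_i$ of the weighted interface projection $\mathcal{N}^w_i$ satisfies $\mathrm{Tr}(\mathcal{S}^w_i)=\mathrm{Tr}(\mathbf{A}^w)|_{\Sigma_i}$, i.e. $\mathcal{S}^w_i$ is a weighted summary of $\mathbf{A}^w$.
   Context: A labelled transition system (LTS) is $\mathcal{A}=(\Sigma,S,T,\lambda,s^0)$ with finite actions, finite states, $T\subseteq S\times S$, $\lambda:T\to\Sigma$, initial state $s^0$; histories are sequences of transitions $t_k=(s_{k-1},s_k)$ with $s_0=s^0$; traces are their label sequences. A weighted LTS $\mathcal{A}^w=(\mathcal{A},c)$ adds $c:T\to\mathbb{R}_{\ge0}$. A weighted trace is $(\sigma,w)$ with $\sigma$ a finite trace and $w$ the minimal total weight of a history labelled $\sigma$; $\mathrm{Tr}(\mathcal{A}^w)$ is the set of weighted traces. (Folded LTSs below may have several labelled, weighted transitions between the same states; weighted traces are defined the same way.) For $\mathcal{A}_j=(\Sigma_j,S_j,T_j,\lambda_j,s^0_j)$, $\mathbf{A}=\mathcal{A}_1\parallel\cdots\parallel\mathcal{A}_n$ has global states in $S_1\times\cdots\times S_n$, initial $(s^0_1,\dots,s^0_n)$,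 and global transitions $\mathbf{t}=(t_1,\dots,t_n)\neq(\star,\dots,\star)$ labelled $a$, with $t_j$ an $a$-transition of $\mathcal{A}_j$ if $a\in\Sigma_j$ and $t_j=\star$ otherwise ($\mathcal{A}_j$ participates iff $t_j\ne\star$); ${}^\bullet\mathbf{t}$/$\mathbf{t}^\bullet$ are source/target states of the $t_j\neq\star$. The weighted composition $\mathbf{A}^w=(\mathbf{A},\mathbf{c})$ has $\mathbf{c}(\mathbf{t})=\sum_{t_j\ne\star}c_j(t_j)$. For a set $W$ of weighted traces, $W|_{\Sigma_i}=\{(\sigma,w): \exists(\sigma',w')\in W,\ \sigma=\sigma'|_{\Sigma_i},\ w=\min\{w':(\sigma',w')\in W,\ \sigma'|_{\Sigma_i}=\sigma\}\}$ ($|_{\Sigma_i}$ = projection onto $\Sigma_i$). The weighted summary problem asks for a weighted LTS $\mathcal{S}^w_i$ with $\mathrm{Tr}(\mathcal{S}^w_i)=\mathrm{Tr}(\mathbf{A}^w)|_{\Sigma_i}$. Branching processes of $\mathbf{A}$: Petri nets with conditions labelled by local states and events labelled by global transitions, defined inductively: the net with conditions $b^0_1,\dots,b^0_n$ labelled $s^0_1,\dots,s^0_n$ and no events is one; if a reachable marking contains a set $M$ of conditions labelled exactly by ${}^\bullet\mathbf{t}$ and no event labelled $\mathbf{t}$ has input set $M$, adding an event labelled $\mathbf{t}$ with inputs $M$ and fresh outputs labelled by the states of $\mathbf{t}^\bullet$ gives a branching process (a possible extension). In the weighted branching process each event $e$ labelled $\mathbf{t}$ has weight $c(e)=\mathbf{c}(\mathbf{t})$.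 $x<y$: nonempty arc path from $x$ to $y$; conflict: some condition $z\ne x,y$ from which both are reached leaving $z$ by different arcs; concurrent: neither causally related nor in conflict. $[e]=\{e':e'\le e\}$, $c([e])=\sum_{e''\in[e]}c(e'')$; $M(e)$: marking reached by firing exactly $[e]$; $M(e)_j$: its condition labelled by a state of $\mathcal{A}_j$; $\mathrm{St}(e)$: global state of labels of $M(e)$. $i$-events: events where $\mathcal{A}_i$ participates; $ip(e)=M(e)_i$. $e'\ll e$ iff $e'<e$ and $b'<b$ for all $b\in M(e)\setminus M(e')$, $b'\in M(e')\setminus M(e)$. For the current $\mathcal{N}$ and a new event $e$: $\mathrm{Con}_i(\mathcal{N},e)$ = non-cut-off $i$-events of $\mathcal{N}$ concurrent with $e$; $e$ is a cut-off if it is an $i$-event and $\mathcal{N}$ contains an $i$-event $e'$ (companion) with $\mathrm{St}(e)=\mathrm{St}(e')$; $e$ is a cut-off candidate of $\mathcal{N}$ if it is not an $i$-event and $\mathcal{N}$ contains $e'\ll e$ with $\mathrm{St}(e)=\mathrm{St}(e')$, $ip(e')=ip(e)$, $\mathrm{Con}_i(\mathcal{N},e)\subseteq\mathrm{Con}_i(\mathcal{N},e')$; $e$ frees a candidate $e_c$ if $e_c$ is no longer a cut-off candidate after adding $e$. Algorithm 2: start with the event-free process, $co=coc=\emptyset$; while some possible extension has no event of $co\cup coc$ in its causal past, choose any such $e$: if a cut-off, add to $co$; else if a cut-off candidate, add to $coc$; else remove from $coc$ every event $e$ frees; then add $e$ to $\mathcal{N}$. At the end $\equiv$ is the smallest equivalence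 on $\mathcal{A}_i$-labelled conditions with $M(e)_i\equiv M(e')_i$ for each $e\in co$ with companion $e'$. Weighted interface projection $\mathcal{N}^w_i$: the LTS whose states are $\mathcal{A}_i$-labelled conditions, initial state $b^0_i$, with a transition $(b,b')$ for each $i$-event $e$ with input $i$-condition $b$, output $i$-condition $b'$, labelled by the action of $e$ and with weight $c_i(e)=c([e])-c([e'])$ if $b$ is the output of an event $e'$ (the predecessor of $e$ in $\mathcal{N}^w_i$), and $c_i(e)=c([e])$ if $b=b^0_i$. Its folding $\mathcal{S}^w_i$ has states $[b]_\equiv$, initial $[b^0_i]_\equiv$, and a transition $([b]_\equiv,[b']_\equiv)$ with the same label and weight for each transition $(b,b')$ of $\mathcal{N}^w_i$. *)

theory Defs
  imports Complex_Main
begin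

record ('s,'a) clts =
  cAct  :: "'a set"
  cSt   :: "'s set"
  cTr   :: "('s \<times> 's) set"
  cLab  :: "'s \<times> 's \<Rightarrow> 'a"
  cInit :: 's

definition wf_wclts :: "('s,'a) clts \<Rightarrow> ('s \<times> 's \<Rightarrow> real) \<Rightarrow> bool" where
  "wf_wclts L c \<longleftrightarrow> finite (cAct L) \<and> finite (cSt L) \<and> cTr L \<subseteq> cSt L \<times> cSt L
     \<and> cInit L \<in> cSt L \<and> (\<forall>t\<in>cTr L. cLab L t \<in> cAct L) \<and> (\<forall>t\<in>cTr L. c t \<ge> 0)"

fun exec :: "('s \<Rightarrow> 't \<Rightarrow> 's option) \<Rightarrow> 's \<Rightarrow> 't list \<Rightarrow> 's option" where
  "exec step s [] = Some s"
| "exec step s (t # h) = (case step s t of None \<Rightarrow> None | Some s' \<Rightarrow> exec step s' h)"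

definition is_hist :: "'t set \<Rightarrow> ('s \<Rightarrow> 't \<Rightarrow> 's option) \<Rightarrow> 's \<Rightarrow> 't list \<Rightarrow> bool" where
  "is_hist T step s0 h \<longleftrightarrow> set h \<subseteq> T \<and> exec step s0 h \<noteq> None"

definition wtraces :: "'t set \<Rightarrow> ('s \<Rightarrow> 't \<Rightarrow> 's option) \<Rightarrow> ('t \<Rightarrow> 'a) \<Rightarrow> ('t \<Rightarrow> real) \<Rightarrow> 's
    \<Rightarrow> ('a list \<times> real) set" where
  "wtraces T step lab wt s0 = {(\<sigma>, w). \<exists>h. is_hist T step s0 h \<and> map lab h = \<sigma>
      \<and> w = sum_list (map wt h)
      \<and> (\<forall>h'. is_hist T step s0 h' \<and> map lab h' = \<sigma> \<longrightarrow> w \<le> sum_list (map wt h'))}"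

definition wproj :: "'a set \<Rightarrow> ('a list \<times> real) set \<Rightarrow> ('a list \<times> real) set" where
  "wproj \<Sigma> W = {(\<sigma>, w). \<exists>\<sigma>'. (\<sigma>', w) \<in> W \<and> \<sigma> = filter (\<lambda>a. a \<in> \<Sigma>) \<sigma>'
      \<and> (\<forall>\<sigma>'' w''. (\<sigma>'', w'') \<in> W \<and> filter (\<lambda>a. a \<in> \<Sigma>) \<sigma>'' = \<sigma> \<longrightarrow> w \<le> w'')}"

text \<open>General (possibly folded) weighted LTS: several labelled weighted transitions
  may connect the same pair of states; transitions are abstract objects.\<close>
record ('s,'t,'a) mlts =
  mSt   :: "'s set"
  mTr   :: "'t set"
  mSrc  :: "'t \<Rightarrow> 's"
  mTgt  :: "'t \<Rightarrow> 's"
  mLab  :: "'t \<Rightarrow> 'a"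
  mWt   :: "'t \<Rightarrow> real"
  mInit :: 's

definition mlts_wtraces :: "('s,'t,'a) mlts \<Rightarrow> ('a list \<times> real) set" where
  "mlts_wtraces L = wtraces (mTr L) (\<lambda>s t. if mSrc L t = s then Some (mTgt L t) else None)
      (mLab L) (mWt L) (mInit L)"

text \<open>A global transition: its action together with the tuple (t_1,...,t_n),
  None standing for the idle symbol star.\<close>
type_synonym ('s,'a) gtr = "'a \<times> (nat \<Rightarrow> ('s \<times> 's) option)"

definition is_gtrans :: "(nat \<Rightarrow> ('s,'a) clts) \<Rightarrow> nat \<Rightarrow> ('s,'a) gtr \<Rightarrow> bool" where
  "is_gtrans A n t \<longleftrightarrow> (\<exists>j<n. snd t j \<noteq> None) \<and>
     (\<forall>j. if j < n \<and> fst t \<in> cAct (A j)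
          then (\<exists>tr. snd t j = Some tr \<and> tr \<in> cTr (A j) \<and> cLab (A j) tr = fst t)
          else snd t j = None)"

definition gstep :: "nat \<Rightarrow> (nat \<Rightarrow> 's) \<Rightarrow> ('s,'a) gtr \<Rightarrow> (nat \<Rightarrow> 's) option" where
  "gstep n st t = (if \<forall>j<n. \<forall>tr. snd t j = Some tr \<longrightarrow> fst tr = st j
      then Some (\<lambda>j. case snd t j of None \<Rightarrow> st j | Some tr \<Rightarrow> snd tr) else None)"

definition gcost :: "nat \<Rightarrow> (nat \<Rightarrow> 's \<times> 's \<Rightarrow> real) \<Rightarrow> ('s,'a) gtr \<Rightarrow> real" where
  "gcost n c t = (\<Sum>j\<in>{j. j < n \<and> snd t j \<noteq> None}. c j (the (snd t j)))"

definition comp_wtraces :: "(nat \<Rightarrow> ('s,'a) clts) \<Rightarrow> (nat \<Rightarrow> 's \<times> 's \<Rightarrow> real) \<Rightarrow> nat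
    \<Rightarrow> ('a list \<times> real) set" where
  "comp_wtraces A c n = wtraces {t. is_gtrans A n t} (gstep n) fst (gcost n c) (\<lambda>j. cInit (A j))"

text \<open>Conditions: the initial conditions b0_j, or the j-th output condition of an
  event. Events: a global transition label together with the list of input conditions,
  ordered by component index.\<close>
datatype 'g cond = Init nat | Out "'g event" nat
and 'g event = Ev (evlab: 'g) (evin: "'g cond list")

type_synonym ('s,'a) ev = "('s,'a) gtr event"
type_synonym ('s,'a) cd = "('s,'a) gtr cond"

definition cidx :: "'g cond \<Rightarrow> nat" where
  "cidx b = (case b of Init j \<Rightarrow> j | Out e j \<Rightarrow> j)"

definition clab :: "(nat \<Rightarrow> ('s,'a) clts) \<Rightarrow> ('s,'a) cd \<Rightarrow> 's" where
  "clab A b = (case b of Init j \<Rightarrow> cInit (A j) | Out e j \<Rightarrow> snd (the (snd (evlab e) j)))"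

definition parts :: "('s,'a) gtr \<Rightarrow> nat list" where
  "parts t = sorted_list_of_set {j. snd t j \<noteq> None}"

definition evout :: "('s,'a) ev \<Rightarrow> ('s,'a) cd list" where
  "evout e = map (Out e) (parts (evlab e))"

definition init_conds :: "nat \<Rightarrow> 'g cond set" where
  "init_conds n = {Init j | j. j < n}"

definition arcs :: "(('s,'a) cd + ('s,'a) ev) rel" where
  "arcs = {(Inl b, Inr e) | b e. b \<in> set (evin e)} \<union> {(Inr e, Inl b) | b e. b \<in> set (evout e)}"

definition evless :: "('s,'a) ev \<Rightarrow> ('s,'a) ev \<Rightarrow> bool" where
  "evless e' e \<longleftrightarrow> (Inr e', Inr e) \<in> arcs\<^sup>+"

definition cdless :: "('s,'a) cd \<Rightarrow> ('s,'a) cd \<Rightarrow> bool" where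
  "cdless b' b \<longleftrightarrow> (Inl b', Inl b) \<in> arcs\<^sup>+"

definition evconflict :: "('s,'a) ev \<Rightarrow> ('s,'a) ev \<Rightarrow> bool" where
  "evconflict x y \<longleftrightarrow> (\<exists>b e1 e2. e1 \<noteq> e2 \<and> b \<in> set (evin e1) \<and> b \<in> set (evin e2)
      \<and> (e1 = x \<or> evless e1 x) \<and> (e2 = y \<or> evless e2 y))"

definition evco :: "('s,'a) ev \<Rightarrow> ('s,'a) ev \<Rightarrow> bool" where
  "evco x y \<longleftrightarrow> \<not> evless x y \<and> \<not> evless y x \<and> \<not> evconflict x y"

definition past :: "('s,'a) ev \<Rightarrow> ('s,'a) ev set" where
  "past e = {e'. e' = e \<or> evless e' e}"

text \<open>M(e): the marking reached by firing exactly [e] (the cut of [e]).\<close>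
definition Mark :: "nat \<Rightarrow> ('s,'a) ev \<Rightarrow> ('s,'a) cd set" where
  "Mark n e = (init_conds n \<union> (\<Union>e'\<in>past e. set (evout e'))) - (\<Union>e'\<in>past e. set (evin e'))"

definition Mj :: "nat \<Rightarrow> ('s,'a) ev \<Rightarrow> nat \<Rightarrow> ('s,'a) cd" where
  "Mj n e j = (THE b. b \<in> Mark n e \<and> cidx b = j)"

definition St :: "(nat \<Rightarrow> ('s,'a) clts) \<Rightarrow> nat \<Rightarrow> ('s,'a) ev \<Rightarrow> 's list" where
  "St A n e = map (\<lambda>j. clab A (Mj n e j)) [0..<n]"

definition iev :: "nat \<Rightarrow> ('s,'a) ev \<Rightarrow> bool" where
  "iev i e \<longleftrightarrow> snd (evlab e) i \<noteq> None"

definition ip :: "nat \<Rightarrow> nat \<Rightarrow> ('s,'a) ev \<Rightarrow> ('s,'a) cd" where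
  "ip n i e = Mj n e i"

definition evll :: "nat \<Rightarrow> ('s,'a) ev \<Rightarrow> ('s,'a) ev \<Rightarrow> bool" where
  "evll n e' e \<longleftrightarrow> evless e' e \<and>
     (\<forall>b\<in>Mark n e - Mark n e'. \<forall>b'\<in>Mark n e' - Mark n e. cdless b' b)"

inductive_set reach :: "nat \<Rightarrow> ('s,'a) ev set \<Rightarrow> ('s,'a) cd set set" for n N where
  reach_init: "init_conds n \<in> reach n N"
| reach_fire: "Mk \<in> reach n N \<Longrightarrow> e \<in> N \<Longrightarrow> set (evin e) \<subseteq> Mk
     \<Longrightarrow> (Mk - set (evin e)) \<union> set (evout e) \<in> reach n N"

definition conds :: "nat \<Rightarrow> ('s,'a) ev set \<Rightarrow> ('s,'a) cd set" where
  "conds n N = init_conds n \<union> (\<Union>e\<in>N. set (evout e))"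

definition pext :: "(nat \<Rightarrow> ('s,'a) clts) \<Rightarrow> nat \<Rightarrow> ('s,'a) ev set \<Rightarrow> ('s,'a) ev \<Rightarrow> bool" where
  "pext A n N e \<longleftrightarrow> e \<notin> N \<and> is_gtrans A n (evlab e)
     \<and> map cidx (evin e) = parts (evlab e)
     \<and> (\<forall>b\<in>set (evin e). clab A b = fst (the (snd (evlab e) (cidx b))))
     \<and> (\<exists>Mk\<in>reach n N. set (evin e) \<subseteq> Mk)"

definition Con :: "nat \<Rightarrow> ('s,'a) ev set \<Rightarrow> ('s,'a) ev set \<Rightarrow> ('s,'a) ev \<Rightarrow> ('s,'a) ev set" where
  "Con i N co e = {e'\<in>N. e' \<notin> co \<and> iev i e' \<and> evco e' e}"

definition is_cutoff :: "(nat \<Rightarrow> ('s,'a) clts) \<Rightarrow> nat \<Rightarrow> nat \<Rightarrow> ('s,'a) ev set \<Rightarrow> ('s,'a) ev \<Rightarrow> bool" where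
  "is_cutoff A n i N e \<longleftrightarrow> iev i e \<and> (\<exists>e'\<in>N. iev i e' \<and> St A n e = St A n e')"

definition is_cand :: "(nat \<Rightarrow> ('s,'a) clts) \<Rightarrow> nat \<Rightarrow> nat \<Rightarrow> ('s,'a) ev set \<Rightarrow> ('s,'a) ev set
    \<Rightarrow> ('s,'a) ev \<Rightarrow> bool" where
  "is_cand A n i N co e \<longleftrightarrow> \<not> iev i e \<and> (\<exists>e'\<in>N. evll n e' e \<and> St A n e = St A n e'
      \<and> ip n i e' = ip n i e \<and> Con i N co e \<subseteq> Con i N co e')"

text \<open>Algorithm state: (N, co, coc, cp) where N is the event set of the current
  branching process, co the cut-offs, coc the cut-off candidates, and cp records each
  cut-off together with its companions (events of N at the time it was added).\<close>
type_synonym ('s,'a) astate = "('s,'a) ev set \<times> ('s,'a) ev set \<times> ('s,'a) ev set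
    \<times> (('s,'a) ev \<times> ('s,'a) ev) set"

definition alg_init :: "('s,'a) astate" where
  "alg_init = ({}, {}, {}, {})"

definition alg_step :: "(nat \<Rightarrow> ('s,'a) clts) \<Rightarrow> nat \<Rightarrow> nat \<Rightarrow> ('s,'a) astate \<Rightarrow> ('s,'a) astate \<Rightarrow> bool" where
  "alg_step A n i X Y \<longleftrightarrow> (case X of (N, co, coc, cp) \<Rightarrow> case Y of (N', co', coc', cp') \<Rightarrow>
     \<exists>e. pext A n N e \<and> (\<forall>e'\<in>co \<union> coc. \<not> evless e' e) \<and> N' = insert e N \<and>
       (if is_cutoff A n i N e
        then co' = insert e co \<and> coc' = coc
             \<and> cp' = cp \<union> {(e, e') | e'. e' \<in> N \<and> iev i e' \<and> St A n e = St A n e'}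
        else co' = co \<and> cp' = cp \<and>
          (if is_cand A n i N co e then coc' = insert e coc
           else coc' = coc - {ec \<in> coc. \<not> is_cand A n i (insert e N) co ec})))"

definition cpast :: "nat \<Rightarrow> (nat \<Rightarrow> 's \<times> 's \<Rightarrow> real) \<Rightarrow> ('s,'a) ev \<Rightarrow> real" where
  "cpast n c e = (\<Sum>e'\<in>past e. gcost n c (evlab e'))"

definition inp :: "nat \<Rightarrow> ('s,'a) ev \<Rightarrow> ('s,'a) cd" where
  "inp i e = (THE b. b \<in> set (evin e) \<and> cidx b = i)"

definition ci :: "nat \<Rightarrow> (nat \<Rightarrow> 's \<times> 's \<Rightarrow> real) \<Rightarrow> nat \<Rightarrow> ('s,'a) ev \<Rightarrow> real" where
  "ci n c i e = (case inp i e of Init _ \<Rightarrow> cpast n c e | Out e' _ \<Rightarrow> cpast n c e - cpast n c e')"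

definition iproj :: "nat \<Rightarrow> (nat \<Rightarrow> 's \<times> 's \<Rightarrow> real) \<Rightarrow> nat \<Rightarrow> ('s,'a) ev set
    \<Rightarrow> (('s,'a) cd, ('s,'a) ev, 'a) mlts" where
  "iproj n c i N = \<lparr> mSt = {b \<in> conds n N. cidx b = i}, mTr = {e \<in> N. iev i e},
     mSrc = inp i, mTgt = (\<lambda>e. Out e i), mLab = (\<lambda>e. fst (evlab e)), mWt = ci n c i,
     mInit = Init i \<rparr>"

definition foldeq :: "nat \<Rightarrow> nat \<Rightarrow> ('s,'a) ev set \<Rightarrow> (('s,'a) ev \<times> ('s,'a) ev) set
    \<Rightarrow> ('s,'a) cd rel" where
  "foldeq n i N cp = \<Inter>{R. equiv {b \<in> conds n N. cidx b = i} R
      \<and> {(Mj n e i, Mj n e' i) | e e'. (e, e') \<in> cp} \<subseteq> R}"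

definition folding :: "('s,'t,'a) mlts \<Rightarrow> 's rel \<Rightarrow> ('s set,'t,'a) mlts" where
  "folding L R = \<lparr> mSt = (\<lambda>b. R `` {b}) ` mSt L, mTr = mTr L,
     mSrc = (\<lambda>t. R `` {mSrc L t}), mTgt = (\<lambda>t. R `` {mTgt L t}),
     mLab = mLab L, mWt = mWt L, mInit = R `` {mInit L} \<rparr>"

end

theory Submission
  imports Defs
begin

text \<open>A configuration of the unfolding is represented by a run, i.e. a list of events fired from a
  marking; a causally closed set of events can always be moved to the front of a run.

  Soundness: a transition \<open>x\<close> of the interface projection stands for a linearisation of \<open>[x]\<close> minus
  the past of its predecessor. Conditions identified by the folding belong to equal global states, so
  these pieces can be concatenated to a global history of the same weight.

  Completeness: follow a global history from the marking of a non-cut-off interface event \<open>e\<close>. If its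
  run contains a final candidate \<open>ec\<close> with witness \<open>e'\<close>, the prefix \<open>[ec]\<close> can be replaced by \<open>[e']\<close>
  without disturbing \<open>[e]\<close>, which gives a shorter and not more expensive history with the same
  interface trace. Otherwise the next interface event belongs to the computed prefix; take the
  corresponding transition and continue from a non-cut-off companion.

  Termination: non-cut-off interface events have distinct global states, so there are finitely many
  and the sets \<open>Con\<close> stabilise. An infinite process contains an infinite causal chain, by Koenig's
  lemma. The components that move infinitely often along the chain keep learning about each other, so
  two late chain events with equal global states and equal \<open>Con\<close> are related by \<open>\<lless>\<close>. The later one
  is then a candidate that is never freed, contradicting that the chain goes on.\<close>

text \<open>The weight of a transition is measured against the past of its interface predecessor.
  While a history is followed, this past must survive every replacement as the very same events,
  whereas labels suffice for whatever comes after it. The definition of a candidate matches this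
  asymmetry: equality of \<open>ip\<close> is used when the predecessor lies below the candidate,
  \<open>evll\<close> with the inclusion of \<open>Con\<close> when the two are concurrent, and
  equal global states take care of the labels.

  For termination the obstacle is \<open>evll\<close>, which wants every new condition above every
  lost one. Repeating a global state along a causal chain does not give this. All pasts flow into
  the chain by definition; what has to be shown is the converse flow, from the chain back into each
  component that keeps moving. A third chain event can then be placed between two others so that it
  lies above the conditions lost by the earlier one and below those gained by the later one.\<close>

type_synonym ('s,'a) marking = "nat \<Rightarrow> ('s,'a) cd"

text \<open>A reachable marking holds exactly one condition per component, so it is encoded as a
  function of the component index rather than as a set.\<close>

definition fire :: "('s,'a) ev \<Rightarrow> ('s,'a) marking \<Rightarrow> ('s,'a) marking" where
  "fire e m = (\<lambda>j. if snd (evlab e) j = None then m j else Out e j)"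

lemma fire_simps:
  "snd (evlab e) j = None \<Longrightarrow> fire e m j = m j"
  "snd (evlab e) j = Some tr \<Longrightarrow> fire e m j = Out e j"
  "snd (evlab e) j \<noteq> None \<Longrightarrow> fire e m j = Out e j"
  by (auto simp: fire_def)

section \<open>Causal order on nested terms\<close>

text \<open>Events and conditions are terms that contain their own history, so an arc always leads
  to a strictly larger term. Acyclicity of causality follows from this alone, without reference to
  any process.\<close>

lemma arcs_size: "(p, q) \<in> arcs \<Longrightarrow> case_sum size size p < case_sum size size q"
proof -
  have *: "b \<in> set (evin e) \<Longrightarrow> size b < size e" for b and e :: "('s,'a) ev"
    by (cases e) (auto dest: size_list_estimation'[OF _ order_refl, of _ _ size])
  show "(p, q) \<in> arcs \<Longrightarrow> ?thesis"
    by (auto simp: arcs_def evout_def *)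
qed

lemma arcs_trancl_size: "(p, q) \<in> arcs\<^sup>+ \<Longrightarrow> case_sum size size p < case_sum size size q"
  by (induction rule: trancl_induct) (auto dest: arcs_size)

lemma evless_irrefl: "\<not> evless e e"
  unfolding evless_def using arcs_trancl_size[of "Inr e" "Inr e"] by auto

lemma cdless_irrefl: "\<not> cdless b b"
  unfolding cdless_def using arcs_trancl_size[of "Inl b" "Inl b"] by auto

lemma evless_trans: "evless x y \<Longrightarrow> evless y z \<Longrightarrow> evless x z"
  unfolding evless_def by (rule trancl_trans)

lemma cdless_trans: "cdless x y \<Longrightarrow> cdless y z \<Longrightarrow> cdless x z"
  unfolding cdless_def by (rule trancl_trans)

definition evcd :: "('s,'a) ev \<Rightarrow> ('s,'a) cd \<Rightarrow> bool" where
  "evcd e b \<longleftrightarrow> (Inr e, Inl b) \<in> arcs\<^sup>+"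

definition cdev :: "('s,'a) cd \<Rightarrow> ('s,'a) ev \<Rightarrow> bool" where
  "cdev b e \<longleftrightarrow> (Inl b, Inr e) \<in> arcs\<^sup>+"

lemma trancl_last_step: "(p, q) \<in> r\<^sup>+ \<longleftrightarrow> (\<exists>z. (z, q) \<in> r \<and> (p = z \<or> (p, z) \<in> r\<^sup>+))"
  by (metis tranclD2 trancl.simps rtrancl_eq_or_trancl)

lemma evcd_iff: "evcd e b \<longleftrightarrow> (\<exists>x j. b = Out x j \<and> j \<in> set (parts (evlab x)) \<and> e \<in> past x)"
  unfolding evcd_def by (subst trancl_last_step) (auto simp: arcs_def evout_def past_def evless_def)

lemma cdev_iff: "cdev b e \<longleftrightarrow> (\<exists>b'\<in>set (evin e). b = b' \<or> cdless b b')"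
  unfolding cdev_def by (subst trancl_last_step) (auto simp: arcs_def cdless_def)

lemma evless_iff: "evless x e \<longleftrightarrow> (\<exists>b\<in>set (evin e). evcd x b)"
  unfolding evcd_def evless_def by (subst trancl_last_step) (auto simp: arcs_def)

lemma cdless_iff: "cdless b b' \<longleftrightarrow> (\<exists>x j. b' = Out x j \<and> j \<in> set (parts (evlab x)) \<and> cdev b x)"
  unfolding cdless_def cdev_def by (subst trancl_last_step) (auto simp: arcs_def evout_def)

lemma cdev_evless: "cdev b x \<Longrightarrow> evless x y \<Longrightarrow> cdev b y"
  unfolding cdev_def evless_def by (rule trancl_trans)

lemma evcd_cdless: "evcd x b \<Longrightarrow> cdless b b' \<Longrightarrow> evcd x b'"
  unfolding evcd_def cdless_def by (rule trancl_trans)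

lemma evcd_cdev: "evcd x b \<Longrightarrow> cdev b y \<Longrightarrow> evless x y"
  unfolding evcd_def cdev_def evless_def by (rule trancl_trans)

lemma cdev_evcd: "cdev b x \<Longrightarrow> evcd x b' \<Longrightarrow> cdless b b'"
  unfolding evcd_def cdev_def cdless_def by (rule trancl_trans)

lemma evless_evcd: "evless x y \<Longrightarrow> evcd y b \<Longrightarrow> evcd x b"
  unfolding evcd_def evless_def by (rule trancl_trans)

lemma past_refl [simp]: "e \<in> past e"
  by (simp add: past_def)

lemma past_trans: "x \<in> past y \<Longrightarrow> y \<in> past z \<Longrightarrow> x \<in> past z"
  by (auto simp: past_def intro: evless_trans)

text \<open>Looks at the first two arcs of the path. It supplies an output of \<open>x\<close> that
  is consumed within \<open>past y\<close> and is therefore missing from the cut of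
  \<open>y\<close>.\<close>

lemma evless_first:
  assumes "evless x y"
  shows "\<exists>z j. j \<in> set (parts (evlab x)) \<and> Out x j \<in> set (evin z) \<and> z \<in> past y"
proof -
  from assms obtain q where q: "(Inr x, q) \<in> arcs" "(q, Inr y) \<in> arcs\<^sup>*"
    unfolding evless_def by (meson tranclD)
  then obtain j where j: "q = Inl (Out x j)" "j \<in> set (parts (evlab x))"
    by (auto simp: arcs_def evout_def)
  with q have "(Inl (Out x j), Inr y) \<in> arcs\<^sup>+" by (auto simp: rtrancl_eq_or_trancl)
  then obtain p where p: "(Inl (Out x j), p) \<in> arcs" "(p, Inr y) \<in> arcs\<^sup>*"
    by (meson tranclD)
  then obtain z where "p = Inr z" "Out x j \<in> set (evin z)"
    by (auto simp: arcs_def)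
  with p j show ?thesis
    by (auto simp: past_def evless_def rtrancl_eq_or_trancl)
qed

lemma cidx_simps [simp]: "cidx (Init j) = j" "cidx (Out e j) = j"
  by (simp_all add: cidx_def)

lemma evless_direct: "Out y j \<in> set (evin x) \<Longrightarrow> j \<in> set (parts (evlab y)) \<Longrightarrow> evless y x"
  unfolding evless_iff evcd_iff by (rule bexI[of _ "Out y j"]) auto

section \<open>Generic facts: executions, Koenig's lemma, causal depth\<close>

lemma exec_Cons_SomeD:
  "exec step s (t # h) \<noteq> None \<Longrightarrow> \<exists>s'. step s t = Some s' \<and> exec step s' h \<noteq> None"
  by (auto split: option.splits)

lemma exec_append:
  "exec step s (xs @ ys) = (case exec step s xs of None \<Rightarrow> None | Some s' \<Rightarrow> exec step s' ys)"
  by (induction xs arbitrary: s) (auto split: option.splits)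

text \<open>The forest is given by a parent function \<open>p\<close> and a level function
  \<open>d\<close>. The set \<open>S y\<close> collects the descendants of \<open>y\<close>; since
  levels are finite, an infinite \<open>S y\<close> must have a child whose own set of descendants
  is infinite.\<close>

lemma koenig:
  fixes X :: "'x set" and d :: "'x \<Rightarrow> nat" and p :: "'x \<Rightarrow> 'x"
  assumes inf: "infinite X" and lev: "\<And>k. finite {x \<in> X. d x = k}"
    and par: "\<And>x k. x \<in> X \<Longrightarrow> d x = Suc k \<Longrightarrow> p x \<in> X \<and> d (p x) = k"
  obtains g :: "nat \<Rightarrow> 'x" where "\<And>k. g k \<in> X" "\<And>k. p (g (Suc k)) = g k \<and> d (g (Suc k)) = Suc (d (g k))"
proof -
  define S where "S y = {x \<in> X. \<exists>m. d x = d y + m \<and> (p ^^ m) x = y}" for y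
  have iter: "(p ^^ m) x \<in> X \<and> d ((p ^^ m) x) = d x - m" if "x \<in> X" "m \<le> d x" for x m
    using that(2)
  proof (induction m)
    case (Suc m)
    then have "(p ^^ m) x \<in> X" "d ((p ^^ m) x) = Suc (d x - Suc m)" by auto
    then show ?case using par by simp
  qed (use that in simp)
  have "X \<subseteq> (\<Union>y\<in>{y \<in> X. d y = 0}. S y)"
  proof
    fix x assume x: "x \<in> X"
    then have "(p ^^ d x) x \<in> X \<and> d ((p ^^ d x) x) = 0" using iter[OF x order_refl] by simp
    then show "x \<in> (\<Union>y\<in>{y \<in> X. d y = 0}. S y)" using x by (auto simp: S_def)
  qed
  then have "\<exists>y\<in>{y \<in> X. d y = 0}. infinite (S y)"
    using inf lev finite_subset by (meson finite_UN_I)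
  then have root: "\<exists>y. y \<in> X \<and> infinite (S y)" by blast
  have step: "\<exists>z. (z \<in> X \<and> infinite (S z)) \<and> p z = y \<and> d z = Suc (d y)" if y: "y \<in> X \<and> infinite (S y)" for y
  proof (rule ccontr)
    assume "\<not> ?thesis"
    then have "finite (S z)" if "z \<in> {z \<in> X. d z = Suc (d y) \<and> p z = y}" for z using that by blast
    moreover have "finite {z \<in> X. d z = Suc (d y) \<and> p z = y}"
      by (rule finite_subset[OF _ lev[of "Suc (d y)"]]) auto
    ultimately have "finite ({x \<in> X. d x = d y} \<union> (\<Union>z\<in>{z \<in> X. d z = Suc (d y) \<and> p z = y}. S z))"
      using lev by blast
    moreover have "S y \<subseteq> {x \<in> X. d x = d y} \<union> (\<Union>z\<in>{z \<in> X. d z = Suc (d y) \<and> p z = y}. S z)"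
    proof
      fix x assume "x \<in> S y"
      then obtain m where m: "x \<in> X" "d x = d y + m" "(p ^^ m) x = y" by (auto simp: S_def)
      show "x \<in> {x \<in> X. d x = d y} \<union> (\<Union>z\<in>{z \<in> X. d z = Suc (d y) \<and> p z = y}. S z)"
      proof (cases m)
        case 0
        then show ?thesis using m by simp
      next
        case (Suc m')
        let ?z = "(p ^^ m') x"
        have "?z \<in> X" "d ?z = Suc (d y)" "p ?z = y" using iter[OF m(1), of m'] m Suc by auto
        moreover from this have "x \<in> S ?z" using m Suc by (auto simp: S_def)
        ultimately show ?thesis by blast
      qed
    qed
    ultimately show False using y finite_subset by blast
  qed
  have "\<exists>g. \<forall>k. (g k \<in> X \<and> infinite (S (g k))) \<and> p (g (Suc k)) = g k \<and> d (g (Suc k)) = Suc (d (g k))"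
    by (rule dependent_nat_choice[of "\<lambda>_ y. y \<in> X \<and> infinite (S y)" "\<lambda>_ y z. p z = y \<and> d z = Suc (d y)"])
      (use root step in blast)+
  then show ?thesis using that by blast
qed

lemma infinite_unbounded: "infinite (L :: nat set) \<Longrightarrow> \<exists>l\<in>L. k \<le> l"
  unfolding finite_nat_set_iff_bounded_le by (meson nat_le_linear)

lemma infinite_sequentially:
  assumes "infinite (L :: nat set)" "eventually Q sequentially"
  obtains l where "l \<in> L" "Q l"
  using assms infinite_unbounded unfolding eventually_sequentially by blast

lemma infinite_Int_atLeast:
  assumes "infinite (L :: nat set)" shows "infinite (L \<inter> {k..})"
proof -
  have "L \<subseteq> (L \<inter> {k..}) \<union> {..<k}" by auto
  then show ?thesis using assms by (metis finite_UnI finite_lessThan finite_subset)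
qed

text \<open>Length of the longest causal chain of events below. In contrast to the term size, it
  drops by exactly one at a suitable direct predecessor, which is the parent function that
  \<open>koenig\<close> asks for. The inserted 0 covers events with initial inputs only.\<close>

primrec cdepth :: "'g cond \<Rightarrow> nat" and edepth :: "'g event \<Rightarrow> nat" where
  "cdepth (Init j) = 0"
| "cdepth (Out e j) = Suc (edepth e)"
| "edepth (Ev t bs) = Max (insert 0 (set (map cdepth bs)))"

lemma edepth_evin: "edepth e = Max (insert 0 (cdepth ` set (evin e)))"
  by (cases e) simp

lemma edepth_less: "Out y j \<in> set (evin x) \<Longrightarrow> edepth y < edepth x"
proof -
  assume "Out y j \<in> set (evin x)"
  then have "cdepth (Out y j) \<in> insert 0 (cdepth ` set (evin x))" by blast
  then have "cdepth (Out y j) \<le> Max (insert 0 (cdepth ` set (evin x)))" by (intro Max_ge) auto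
  then show ?thesis by (simp add: edepth_evin[of x])
qed

lemma edepth_Suc:
  assumes "edepth x = Suc k" shows "\<exists>y j. Out y j \<in> set (evin x) \<and> edepth y = k"
proof -
  have "Max (insert 0 (cdepth ` set (evin x))) \<in> insert 0 (cdepth ` set (evin x))"
    by (rule Max_in) auto
  then obtain b where b: "b \<in> set (evin x)" "cdepth b = Suc k"
    using assms by (auto simp: edepth_evin[of x])
  then show ?thesis by (cases b rule: cond.exhaust) auto
qed

lemma finite_subset_increasing_union:
  fixes F :: "nat \<Rightarrow> 'b set"
  assumes "finite S" "S \<subseteq> (\<Union>k. F k)" "mono F" shows "\<exists>k. S \<subseteq> F k"
  using assms(1,2)
proof (induction S rule: finite_induct)
  case (insert x S)
  then obtain k l where "S \<subseteq> F k" "x \<in> F l" by auto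
  then have "insert x S \<subseteq> F (max k l)"
    using monoD[OF assms(3), of k "max k l"] monoD[OF assms(3), of l "max k l"] by auto
  then show ?case ..
qed simp

section \<open>Runs of the composition and their global histories\<close>

locale composition =
  fixes A :: "nat \<Rightarrow> ('s,'a) clts" and c :: "nat \<Rightarrow> 's \<times> 's \<Rightarrow> real" and n i :: nat
  assumes i_less: "i < n" and wf: "\<And>j. j < n \<Longrightarrow> wf_wclts (A j) (c j)"
begin

definition enabled :: "('s,'a) marking \<Rightarrow> ('s,'a) ev \<Rightarrow> bool" where
  "enabled m e \<longleftrightarrow> is_gtrans A n (evlab e) \<and> evin e = map m (parts (evlab e))
     \<and> (\<forall>j tr. snd (evlab e) j = Some tr \<longrightarrow> fst tr = clab A (m j))"

fun run :: "('s,'a) marking \<Rightarrow> ('s,'a) ev list \<Rightarrow> bool" where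
  "run m [] \<longleftrightarrow> True"
| "run m (e # es) \<longleftrightarrow> enabled m e \<and> run (fire e m) es"

abbreviation fires :: "('s,'a) marking \<Rightarrow> ('s,'a) ev list \<Rightarrow> ('s,'a) marking" where
  "fires m es \<equiv> fold fire es m"

definition gstate :: "('s,'a) marking \<Rightarrow> nat \<Rightarrow> 's" where
  "gstate m = (\<lambda>j. clab A (m j))"

lemma run_append: "run m (xs @ ys) \<longleftrightarrow> run m xs \<and> run (fires m xs) ys"
  by (induction xs arbitrary: m) auto

lemma gtrans_less: "is_gtrans A n t \<Longrightarrow> snd t j \<noteq> None \<Longrightarrow> j < n"
  unfolding is_gtrans_def by meson

lemma set_parts: "is_gtrans A n t \<Longrightarrow> set (parts t) = {j. snd t j \<noteq> None}"
  unfolding parts_def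
  by (rule set_sorted_list_of_set, rule finite_subset[of _ "{..<n}"]) (auto dest: gtrans_less)

lemma gtrans_i: "is_gtrans A n t \<Longrightarrow> snd t i \<noteq> None \<longleftrightarrow> fst t \<in> cAct (A i)"
  unfolding is_gtrans_def using i_less by (metis option.distinct(1))

lemma gtrans_tr:
  assumes "is_gtrans A n t" "snd t j = Some tr"
  shows "j < n" "tr \<in> cTr (A j)" "fst t \<in> cAct (A j)"
proof -
  have "if j < n \<and> fst t \<in> cAct (A j)
          then (\<exists>tr. snd t j = Some tr \<and> tr \<in> cTr (A j) \<and> cLab (A j) tr = fst t)
          else snd t j = None"
    using assms(1) unfolding is_gtrans_def by blast
  then show "j < n" "tr \<in> cTr (A j)" "fst t \<in> cAct (A j)"
    using assms(2) by (auto split: if_splits)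
qed

lemma gcost_nonneg:
  assumes "is_gtrans A n t" shows "0 \<le> gcost n c t"
  unfolding gcost_def
proof (rule sum_nonneg)
  fix j assume "j \<in> {j. j < n \<and> snd t j \<noteq> None}"
  then obtain tr where tr: "snd t j = Some tr" "j < n" by blast
  then have "tr \<in> cTr (A j)" using gtrans_tr[OF assms] by blast
  then show "0 \<le> c j (the (snd t j))"
    using wf[OF tr(2)] tr(1) by (simp add: wf_wclts_def)
qed

lemma enabled_parts: "enabled m e \<Longrightarrow> set (parts (evlab e)) = {j. snd (evlab e) j \<noteq> None}"
  by (simp add: enabled_def set_parts)

lemma enabled_evin: "enabled m e \<Longrightarrow> set (evin e) = m ` {j. snd (evlab e) j \<noteq> None}"
  by (simp add: enabled_def set_parts)

lemma enabled_gstep: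
  assumes "enabled m e" shows "gstep n (gstate m) (evlab e) = Some (gstate (fire e m))"
proof -
  have "(\<lambda>j. case snd (evlab e) j of None \<Rightarrow> gstate m j | Some tr \<Rightarrow> snd tr) = gstate (fire e m)"
    by (auto simp: gstate_def fire_def clab_def fun_eq_iff split: option.split)
  moreover have "\<forall>j<n. \<forall>tr. snd (evlab e) j = Some tr \<longrightarrow> fst tr = gstate m j"
    using assms by (simp add: enabled_def gstate_def)
  ultimately show ?thesis by (simp add: gstep_def)
qed

lemma run_exec: "run m es \<Longrightarrow> exec (gstep n) (gstate m) (map evlab es) = Some (gstate (fires m es))"
  by (induction es arbitrary: m) (auto simp: enabled_gstep)

lemma run_gtrans: "run m es \<Longrightarrow> e \<in> set es \<Longrightarrow> is_gtrans A n (evlab e)"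
  by (induction es arbitrary: m) (auto simp: enabled_def)

text \<open>The event is forced at each step: its label comes from the history and its input list
  from the current marking. A history therefore lifts to a run from any marking with the right
  global state.\<close>

lemma exec_run:
  "exec (gstep n) (gstate m) ts \<noteq> None \<Longrightarrow> set ts \<subseteq> {t. is_gtrans A n t}
    \<Longrightarrow> \<exists>es. run m es \<and> map evlab es = ts"
proof (induction ts arbitrary: m)
  case Nil
  then show ?case by (intro exI[of _ "[]"]) simp
next
  case (Cons t ts)
  define e where "e = Ev t (map m (parts t))"
  have "gstep n (gstate m) t \<noteq> None" using Cons.prems by (auto split: option.splits)
  moreover have gt: "is_gtrans A n t" using Cons.prems by simp
  ultimately have en: "enabled m e"
    by (auto simp: e_def enabled_def gstep_def gstate_def split: if_splits dest!: gtrans_less)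
  have lab: "evlab e = t" by (simp add: e_def)
  have "exec (gstep n) (gstate (fire e m)) ts \<noteq> None"
    using Cons.prems enabled_gstep[OF en] lab by simp
  then obtain es where "run (fire e m) es" "map evlab es = ts" using Cons by auto
  then show ?case using en lab by (intro exI[of _ "e # es"]) simp
qed

subsection \<open>Reordering runs\<close>

text \<open>If \<open>a\<close> and the event \<open>d\<close> right after it moved a common
  component \<open>j\<close>, then \<open>d\<close> would consume \<open>Out a j\<close>. Hence they
  move disjoint components and commute; repeat for the rest of \<open>ds\<close>.\<close>

lemma run_postpone:
  "run m (a # ds) \<Longrightarrow> (\<And>d j. d \<in> set ds \<Longrightarrow> Out a j \<notin> set (evin d))
    \<Longrightarrow> run m (ds @ [a]) \<and> fires m (ds @ [a]) = fires m (a # ds)"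
proof (induction ds arbitrary: m)
  case Nil
  then show ?case by simp
next
  case (Cons d ds)
  have ea: "enabled m a" and ed: "enabled (fire a m) d" and r: "run (fire d (fire a m)) ds"
    using Cons.prems by auto
  have disj: "snd (evlab a) j = None" if "snd (evlab d) j \<noteq> None" for j
  proof (rule ccontr)
    assume "snd (evlab a) j \<noteq> None"
    then have "Out a j \<in> set (evin d)"
      using that enabled_evin[OF ed] by (force simp: fire_def)
    then show False using Cons.prems(2) by auto
  qed
  have eq: "fire a m j = m j" if "snd (evlab d) j \<noteq> None" for j
    using disj[OF that] by (simp add: fire_def)
  have eq': "fire d m j = m j" if "snd (evlab a) j \<noteq> None" for j
    using disj[of j] that by (auto simp: fire_def)
  have ed': "enabled m d"
    using ed eq enabled_parts[OF ed] by (auto simp: enabled_def)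
  have ea': "enabled (fire d m) a"
    using ea eq' enabled_parts[OF ea] by (auto simp: enabled_def)
  have comm: "fire a (fire d m) = fire d (fire a m)"
    using disj by (auto simp: fire_def fun_eq_iff)
  have "run (fire d m) (a # ds)" using ea' comm r by simp
  then have "run (fire d m) (ds @ [a]) \<and> fires (fire d m) (ds @ [a]) = fires (fire d m) (a # ds)"
    using Cons.IH Cons.prems(2) by (metis list.set_intros(2))
  then show ?case using ed' comm by simp
qed

text \<open>\<open>P\<close> is closed under direct predecessors, so an event outside
  \<open>P\<close> feeds no event inside \<open>P\<close> and can be postponed behind all of them.
  The partition is stable: both parts keep their internal order.\<close>

lemma run_reorder:
  "run m es \<Longrightarrow> (\<And>x y j. x \<in> set es \<Longrightarrow> P x \<Longrightarrow> Out y j \<in> set (evin x) \<Longrightarrow> y \<in> set es \<Longrightarrow> P y)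
    \<Longrightarrow> run m (filter P es @ filter (\<lambda>x. \<not> P x) es)
      \<and> fires m (filter P es @ filter (\<lambda>x. \<not> P x) es) = fires m es"
proof (induction es arbitrary: m)
  case Nil
  then show ?case by simp
next
  case (Cons a es)
  let ?ds = "filter P es" and ?rs = "filter (\<lambda>x. \<not> P x) es"
  have IH: "run (fire a m) (?ds @ ?rs)" "fires (fire a m) (?ds @ ?rs) = fires (fire a m) es"
    using Cons.IH[of "fire a m"] Cons.prems by (auto intro: Cons.prems(2))
  show ?case
  proof (cases "P a")
    case True
    then show ?thesis using IH Cons.prems by simp
  next
    case False
    have "run m (a # ?ds)" using IH Cons.prems by (simp add: run_append)
    moreover have "Out a j \<notin> set (evin d)" if "d \<in> set ?ds" for d j
      using that False Cons.prems(2)[of d a j] by auto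
    ultimately have "run m (?ds @ [a]) \<and> fires m (?ds @ [a]) = fires m (a # ?ds)"
      by (rule run_postpone)
    then show ?thesis using IH False by (auto simp: run_append)
  qed
qed

text \<open>The events stay literally the same, not just their labels: none of them consumes a
  condition in which the markings differ, and elsewhere both markings hold the same condition. This
  permits exchanging a prefix beneath events that have to be kept.\<close>

lemma run_transfer:
  "run m u \<Longrightarrow> (\<And>x j. x \<in> set u \<Longrightarrow> m j \<noteq> m' j \<Longrightarrow> m j \<notin> set (evin x)) \<Longrightarrow> gstate m = gstate m'
    \<Longrightarrow> run m' u \<and> gstate (fires m u) = gstate (fires m' u)"
proof (induction u arbitrary: m m')
  case Nil
  then show ?case by simp
next
  case (Cons a u)
  have ea: "enabled m a" and r: "run (fire a m) u" using Cons.prems by auto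
  have eq: "m j = m' j" if "snd (evlab a) j \<noteq> None" for j
    using Cons.prems(2)[of a j] enabled_evin[OF ea] that by auto
  have ea': "enabled m' a"
    using ea eq enabled_parts[OF ea] by (auto simp: enabled_def)
  have "gstate (fire a m) = gstate (fire a m')"
    using Cons.prems(3) by (auto simp: gstate_def fire_def fun_eq_iff)
  moreover have "fire a m j \<notin> set (evin x)" if "x \<in> set u" "fire a m j \<noteq> fire a m' j" for x j
    using that Cons.prems(2)[of x j] by (auto simp: fire_def split: if_splits)
  ultimately have "run (fire a m') u \<and> gstate (fires (fire a m) u) = gstate (fires (fire a m') u)"
    using r by (intro Cons.IH) auto
  then show ?case using ea' by simp
qed

subsection \<open>Runs from the initial marking\<close>

lemma fires_cidx: "(\<And>j. cidx (m j) = j) \<Longrightarrow> cidx (fires m es j) = j"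
  by (induction es arbitrary: m) (auto simp: fire_def)

lemma run_evin_cidx:
  "run m es \<Longrightarrow> (\<And>j. cidx (m j) = j) \<Longrightarrow> e \<in> set es \<Longrightarrow> map cidx (evin e) = parts (evlab e)"
proof (induction es arbitrary: m)
  case (Cons a es)
  have "cidx (fire a m j) = j" for j using Cons.prems by (simp add: fire_def)
  moreover have "map cidx (evin a) = parts (evlab a)"
    using Cons.prems by (simp add: enabled_def o_def)
  ultimately show ?case using Cons by auto
qed simp

lemma run_init_marking:
  "run Init es \<Longrightarrow> fires Init es j = Init j
    \<or> (\<exists>x\<in>set es. fires Init es j = Out x j \<and> snd (evlab x) j \<noteq> None)"
proof (induction es rule: rev_induct)
  case (snoc e es)
  then show ?case
    by (cases "snd (evlab e) j = None") (auto simp: run_append fire_simps)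
qed simp

lemma run_evin_cases:
  assumes "run Init es" "x \<in> set es" "b \<in> set (evin x)"
  obtains j where "b = Init j" "j < n" | y j where "b = Out y j" "y \<in> set es" "snd (evlab y) j \<noteq> None"
proof -
  obtain as bs where es: "es = as @ x # bs" using assms(2) by (meson split_list)
  then have "run Init as" "enabled (fires Init as) x" using assms(1) by (auto simp: run_append)
  with assms(3) obtain j where j: "b = fires Init as j" "snd (evlab x) j \<noteq> None"
    by (auto simp: enabled_evin)
  moreover have "j < n" using j(2) \<open>enabled _ x\<close> by (auto simp: enabled_def dest: gtrans_less)
  ultimately show ?thesis
    using run_init_marking[OF \<open>run Init as\<close>, of j] that es by auto
qed

lemma run_pred_closed:
  "run Init es \<Longrightarrow> x \<in> set es \<Longrightarrow> Out y j \<in> set (evin x) \<Longrightarrow> y \<in> set es"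
  by (erule (2) run_evin_cases) auto

lemma run_pred_parts:
  assumes "run Init es" "x \<in> set es" "Out y j \<in> set (evin x)"
  shows "j \<in> set (parts (evlab y))"
proof -
  have "y \<in> set es" "snd (evlab y) j \<noteq> None"
    using assms by (auto elim: run_evin_cases)
  then show ?thesis using set_parts run_gtrans assms(1) by blast
qed

lemma run_evless_closed:
  assumes "run Init es" "x \<in> set es" "evless y x" shows "y \<in> set es"
proof -
  have "q \<in> Inr ` set es \<union> Inl ` (\<Union>x\<in>set es. set (evin x)) \<Longrightarrow> p \<in> Inr ` set es \<union> Inl ` (\<Union>x\<in>set es. set (evin x))"
    if "(p, q) \<in> arcs\<^sup>+" for p q
    using that
    by (induction rule: converse_trancl_induct)
       (auto simp: arcs_def evout_def image_iff dest: run_pred_closed[OF assms(1)])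
  from this[of "Inr y" "Inr x"] assms(2,3) show ?thesis by (auto simp: evless_def)
qed

lemma run_past: "run Init es \<Longrightarrow> x \<in> set es \<Longrightarrow> past x \<subseteq> set es"
  using run_evless_closed by (auto simp: past_def)

lemma enabled_new:
  assumes "run Init es" "\<And>x j. x \<in> set es \<Longrightarrow> fires Init es j \<notin> set (evin x)"
    "enabled (fires Init es) e"
  shows "e \<notin> set es"
proof
  assume "e \<in> set es"
  obtain j where "snd (evlab e) j \<noteq> None"
    using assms(3) unfolding enabled_def is_gtrans_def by blast
  then have "fires Init es j \<in> set (evin e)" using enabled_evin[OF assms(3)] by blast
  then show False using assms(2) \<open>e \<in> set es\<close> by blast
qed

text \<open>A fresh output \<open>Out e j\<close> is an input of an earlier event only if
  \<open>e\<close> itself fired earlier, and an input of \<open>e\<close> only if \<open>e\<close>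
  lies below itself. Both are impossible.\<close>

lemma run_consumed:
  "run Init es \<Longrightarrow> x \<in> set es \<Longrightarrow> fires Init es j \<notin> set (evin x)"
proof (induction es arbitrary: x j rule: rev_induct)
  case (snoc e es)
  have r: "run Init es" and en: "enabled (fires Init es) e" using snoc.prems by (auto simp: run_append)
  have IH: "\<And>x j. x \<in> set es \<Longrightarrow> fires Init es j \<notin> set (evin x)" using snoc r by blast
  have new: "e \<notin> set es" by (rule enabled_new[OF r IH en])
  have self: "Out e j \<notin> set (evin e)"
  proof
    assume "Out e j \<in> set (evin e)"
    then have "j \<in> set (parts (evlab e))" using run_pred_parts snoc.prems(1) by force
    with \<open>Out e j \<in> set (evin e)\<close> have "evless e e"
      by (rule evless_direct)
    then show False using evless_irrefl by blast
  qed
  show ?case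
  proof (cases "snd (evlab e) j = None")
    case True
    have "fires Init es j \<notin> set (evin e)"
    proof
      assume "fires Init es j \<in> set (evin e)"
      then obtain j' where "fires Init es j = fires Init es j'" "snd (evlab e) j' \<noteq> None"
        by (auto simp: enabled_evin[OF en])
      moreover have "j = j'"
        using arg_cong[OF calculation(1), of cidx] by (simp add: fires_cidx)
      ultimately show False using True by simp
    qed
    then show ?thesis using True IH snoc.prems by (auto simp: fire_simps)
  next
    case False
    have "Out e j \<notin> set (evin x)"
      using snoc.prems(2) self new run_pred_closed[OF r, of x e j] by auto
    then show ?thesis using False by (simp add: fire_simps)
  qed
qed simp

lemma run_distinct: "run Init es \<Longrightarrow> distinct es"
proof (induction es rule: rev_induct)
  case (snoc e es)
  then have "run Init es" "enabled (fires Init es) e" by (auto simp: run_append)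
  then show ?case using snoc enabled_new run_consumed by simp
qed simp

lemma run_no_conflict:
  "run Init es \<Longrightarrow> x \<in> set es \<Longrightarrow> y \<in> set es \<Longrightarrow> b \<in> set (evin x) \<Longrightarrow> b \<in> set (evin y) \<Longrightarrow> x = y"
proof (induction es rule: rev_induct)
  case (snoc e es)
  then have r: "run Init es" and en: "enabled (fires Init es) e" by (auto simp: run_append)
  have "set (evin e) \<inter> set (evin z) = {}" if "z \<in> set es" for z
    using run_consumed[OF r that] by (auto simp: enabled_evin[OF en])
  then show ?case using snoc r by auto
qed simp

lemma run_output:
  "run Init es \<Longrightarrow> x \<in> set es \<Longrightarrow> snd (evlab x) j \<noteq> None
    \<Longrightarrow> fires Init es j = Out x j \<or> (\<exists>y\<in>set es. Out x j \<in> set (evin y))"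
proof (induction es rule: rev_induct)
  case (snoc e es)
  then have r: "run Init es" and en: "enabled (fires Init es) e" by (auto simp: run_append)
  show ?case
  proof (cases "x = e")
    case True
    then show ?thesis using snoc by (simp add: fire_simps)
  next
    case False
    then have "fires Init es j = Out x j \<or> (\<exists>y\<in>set es. Out x j \<in> set (evin y))"
      using snoc r by simp
    moreover have "fires Init es j \<in> set (evin e)" if "snd (evlab e) j \<noteq> None"
      using that enabled_evin[OF en] by blast
    ultimately show ?thesis
      by (cases "snd (evlab e) j = None") (auto simp: fire_simps)
  qed
qed simp

lemma run_init_output:
  "run Init es \<Longrightarrow> fires Init es j = Init j \<or> (\<exists>y\<in>set es. Init j \<in> set (evin y))"
proof (induction es rule: rev_induct)
  case (snoc e es)
  then have r: "run Init es" and en: "enabled (fires Init es) e" by (auto simp: run_append)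
  have "fires Init es j = Init j \<or> (\<exists>y\<in>set es. Init j \<in> set (evin y))" using snoc r by blast
  moreover have "fires Init es j \<in> set (evin e)" if "snd (evlab e) j \<noteq> None"
    using that enabled_evin[OF en] by blast
  ultimately show ?case
    by (cases "snd (evlab e) j = None") (auto simp: fire_simps)
qed simp

lemma run_outside: 
  assumes "run m es" "n \<le> j" shows "fires m es j = m j"
proof -
  have "fire e m' j = m' j" if "enabled m' e" for e m'
    using that assms(2) gtrans_less[of "evlab e" j] by (auto simp: fire_def enabled_def)
  then have "run m es \<Longrightarrow> fires m es j = m j"
    by (induction es arbitrary: m) auto
  then show ?thesis using assms(1) .
qed

lemma set_evout: "is_gtrans A n (evlab e) \<Longrightarrow> set (evout e) = Out e ` {j. snd (evlab e) j \<noteq> None}"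
  by (simp add: evout_def set_parts)

text \<open>The left side depends only on the set of fired events. This connects markings of runs
  with \<open>Mark\<close> and makes the marking reached independent of the firing order.\<close>

lemma run_cut:
  assumes r: "run Init es"
  shows "(init_conds n \<union> (\<Union>e\<in>set es. set (evout e))) - (\<Union>e\<in>set es. set (evin e)) = fires Init es ` {..<n}"
    (is "?L = ?R")
proof
  show "?L \<subseteq> ?R"
  proof
    fix b assume b: "b \<in> ?L"
    then consider j where "b = Init j" "j < n" | e where "e \<in> set es" "b \<in> set (evout e)"
      by (auto simp: init_conds_def)
    then show "b \<in> ?R"
    proof cases
      case 1
      then have "b = fires Init es j" using run_init_output[OF r, of j] b by auto
      then show ?thesis using 1 by blast
    next
      case 2
      have gt: "is_gtrans A n (evlab e)" using run_gtrans[OF r] 2 by blast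
      then obtain j where j: "b = Out e j" "snd (evlab e) j \<noteq> None" using 2 by (auto simp: set_evout)
      then have "j < n" using gt gtrans_less by blast
      moreover have "b = fires Init es j" using run_output[OF r 2(1) j(2)] b j by auto
      ultimately show ?thesis by blast
    qed
  qed
  show "?R \<subseteq> ?L"
  proof
    fix b assume "b \<in> ?R"
    then obtain j where j: "j < n" "b = fires Init es j" by auto
    have "b \<in> init_conds n \<union> (\<Union>e\<in>set es. set (evout e))"
      using run_init_marking[OF r, of j]
    proof
      assume "fires Init es j = Init j"
      then show ?thesis using j by (auto simp: init_conds_def)
    next
      assume "\<exists>x\<in>set es. fires Init es j = Out x j \<and> snd (evlab x) j \<noteq> None"
      then obtain x where x: "x \<in> set es" "b = Out x j" "snd (evlab x) j \<noteq> None" using j by auto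
      then have "b \<in> set (evout x)" using set_evout run_gtrans[OF r] by blast
      then show ?thesis using x by blast
    qed
    then show "b \<in> ?L" using run_consumed[OF r] j by auto
  qed
qed

lemma run_same_set:
  assumes "run Init es" "run Init es'" "set es = set es'"
  shows "fires Init es = fires Init es'"
proof
  fix j
  show "fires Init es j = fires Init es' j"
  proof (cases "j < n")
    case True
    have "fires Init es ` {..<n} = fires Init es' ` {..<n}"
      using assms by (simp add: run_cut[symmetric])
    then obtain j' where "fires Init es j = fires Init es' j'" using True by blast
    moreover have "j = j'"
      using arg_cong[OF calculation, of cidx] by (simp add: fires_cidx)
    ultimately show ?thesis by simp
  next
    case False
    then show ?thesis using run_outside assms by simp
  qed
qed

subsection \<open>Events of the unfolding and their markings\<close>

definition unf :: "('s,'a) ev \<Rightarrow> bool" where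
  "unf x \<longleftrightarrow> (\<exists>es. run Init es \<and> x \<in> set es)"

text \<open>The default \<open>Init j\<close> beyond the components is what every run from
  \<open>Init\<close> leaves there, so \<open>mk x\<close> equals the marking of a linearisation of
  \<open>past x\<close> as a function, not only below \<open>n\<close>.\<close>

definition mk :: "('s,'a) ev \<Rightarrow> ('s,'a) marking" where
  "mk x = (\<lambda>j. if j < n then Mj n x j else Init j)"

lemma run_split:
  assumes r: "run Init es" and D: "D \<subseteq> set es"
    and cl: "\<And>x y. x \<in> D \<Longrightarrow> evless y x \<Longrightarrow> y \<in> D"
  obtains ds rs where "run Init (ds @ rs)" "fires Init (ds @ rs) = fires Init es"
    "set ds = D" "set rs = set es - D" "rs = filter (\<lambda>x. x \<notin> D) es"
proof -
  have "run Init (filter (\<lambda>x. x \<in> D) es @ filter (\<lambda>x. x \<notin> D) es) \<and>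
    fires Init (filter (\<lambda>x. x \<in> D) es @ filter (\<lambda>x. x \<notin> D) es) = fires Init es"
  proof (rule run_reorder[OF r])
    fix x y j assume "x \<in> set es" "x \<in> D" "Out y j \<in> set (evin x)"
    then have "evless y x"
      using run_pred_parts[OF r] evless_direct by blast
    then show "y \<in> D" using cl \<open>x \<in> D\<close> by blast
  qed
  moreover have "set (filter (\<lambda>x. x \<in> D) es) = D" "set (filter (\<lambda>x. x \<notin> D) es) = set es - D"
    using D by auto
  ultimately show ?thesis using that by blast
qed

lemma run_past_marking:
  assumes r: "run Init es" and s: "set es = past x"
  shows "Mark n x = fires Init es ` {..<n}" "mk x = fires Init es"
proof -
  show *: "Mark n x = fires Init es ` {..<n}"
    unfolding Mark_def s[symmetric] using run_cut[OF r] by simp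
  have "Mj n x j = fires Init es j" if "j < n" for j
    unfolding Mj_def *
  proof (rule the_equality)
    show "fires Init es j \<in> fires Init es ` {..<n} \<and> cidx (fires Init es j) = j"
      using that fires_cidx[of Init] by auto
    fix b assume "b \<in> fires Init es ` {..<n} \<and> cidx b = j"
    then show "b = fires Init es j" using fires_cidx[of Init] by auto
  qed
  then show "mk x = fires Init es"
    using run_outside[OF r] by (auto simp: mk_def fun_eq_iff)
qed

lemma past_lin:
  assumes "unf x"
  obtains es where "run Init es" "set es = past x" "mk x = fires Init es" "Mark n x = fires Init es ` {..<n}"
proof -
  obtain es where es: "run Init es" "x \<in> set es" using assms by (auto simp: unf_def)
  obtain ds rs where "run Init (ds @ rs)" "set ds = past x"
    by (rule run_split[OF es(1) run_past[OF es]]) (auto simp: past_def intro: evless_trans)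
  then show ?thesis using that run_past_marking by (auto simp: run_append)
qed

lemma Mark_mk: "unf x \<Longrightarrow> Mark n x = mk x ` {..<n}"
  by (erule past_lin) simp

lemma unf_past: "unf x \<Longrightarrow> y \<in> past x \<Longrightarrow> unf y"
  unfolding unf_def using run_past by blast

lemma finite_past: "unf x \<Longrightarrow> finite (past x)"
  by (erule past_lin) (metis List.finite_set)

lemma unf_gtrans: "unf x \<Longrightarrow> is_gtrans A n (evlab x)"
  by (auto simp: unf_def run_gtrans)

lemma unf_parts: "unf x \<Longrightarrow> set (parts (evlab x)) = {j. snd (evlab x) j \<noteq> None}"
  by (simp add: set_parts unf_gtrans)

lemma mk_cidx: "unf x \<Longrightarrow> cidx (mk x j) = j"
  by (erule past_lin) (simp add: fires_cidx)

lemma mk_cases: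
  assumes "unf x"
  obtains "mk x j = Init j" | y where "mk x j = Out y j" "y \<in> past x" "snd (evlab y) j \<noteq> None"
proof -
  obtain es where es: "run Init es" "set es = past x" "mk x = fires Init es"
    using assms by (rule past_lin)
  show ?thesis using run_init_marking[OF es(1), of j] es(2,3) that by auto
qed

lemma mk_own:
  assumes "unf x" "snd (evlab x) j \<noteq> None" shows "mk x j = Out x j"
proof -
  obtain es where es: "run Init es" "set es = past x" "mk x = fires Init es"
    using assms(1) by (rule past_lin)
  have "\<not> Out x j \<in> set (evin y)" if "y \<in> set es" for y
  proof
    assume "Out x j \<in> set (evin y)"
    then have "evless x y" using assms by (intro evless_direct) (auto simp: unf_parts)
    moreover have "y = x \<or> evless y x" using that es by (simp add: past_def)
    ultimately show False using evless_trans evless_irrefl by blast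
  qed
  then show ?thesis using run_output[OF es(1), of x j] es assms by auto
qed

lemma unf_evin:
  assumes "unf x" shows "map cidx (evin x) = parts (evlab x)" 
    and "\<And>j. snd (evlab x) j \<noteq> None \<Longrightarrow> inp j x \<in> set (evin x)"
    and "\<And>j b. b \<in> set (evin x) \<Longrightarrow> cidx b = j \<Longrightarrow> inp j x = b"
proof -
  show *: "map cidx (evin x) = parts (evlab x)"
    using assms run_evin_cidx[of Init] by (auto simp: unf_def)
  have "distinct (map cidx (evin x))" unfolding * parts_def by simp
  then have inj: "inj_on cidx (set (evin x))" by (simp add: distinct_map)
  show **: "inp j x = b" if "b \<in> set (evin x)" "cidx b = j" for j b
    unfolding inp_def using inj that by (auto intro!: the_equality dest: inj_onD)
  fix j assume "snd (evlab x) j \<noteq> None"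
  then have "j \<in> cidx ` set (evin x)"
    using unf_parts[OF assms] by (simp add: *[symmetric])
  then show "inp j x \<in> set (evin x)" using ** by auto
qed

section \<open>Causal order along a run\<close>

definition cle :: "('s,'a) cd \<Rightarrow> ('s,'a) cd \<Rightarrow> bool" where
  "cle b b' \<longleftrightarrow> b = b' \<or> cdless b b'"

lemma cle_trans: "cle x y \<Longrightarrow> cle y z \<Longrightarrow> cle x z"
  by (auto simp: cle_def intro: cdless_trans)

lemma cle_antisym: "cle x y \<Longrightarrow> cle y x \<Longrightarrow> x = y"
  using cdless_trans cdless_irrefl unfolding cle_def by blast

lemma run_cle: "run m es \<Longrightarrow> cle (m j) (fires m es j)"
proof (induction es arbitrary: m)
  case (Cons e es)
  have "cle (m j) (fire e m j)"
  proof (cases "snd (evlab e) j = None")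
    case True
    then show ?thesis by (simp add: fire_simps cle_def)
  next
    case False
    have en: "enabled m e" using Cons.prems by simp
    have "m j \<in> set (evin e)" using enabled_evin[OF en] False by blast
    then have "cdev (m j) e" unfolding cdev_iff by blast
    moreover have "evcd e (Out e j)"
      unfolding evcd_iff using enabled_parts[OF en] False past_refl by blast
    ultimately show ?thesis using False by (simp add: fire_simps cle_def cdev_evcd)
  qed
  moreover have "cle (fire e m j) (fires (fire e m) es j)" using Cons by auto
  ultimately show ?case using cle_trans[of "m j"] by simp
qed (simp add: cle_def)

lemma run_past_split:
  assumes r: "run Init es" and x: "x \<in> set es"
  obtains ds rs where "run Init ds" "set ds = past x" "fires Init ds = mk x"
    "run (mk x) rs" "fires (mk x) rs = fires Init es" "run Init (ds @ rs)"
    "set rs = set es - past x" "rs = filter (\<lambda>y. y \<notin> past x) es"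
proof -
  obtain ds rs where ds: "run Init (ds @ rs)" "fires Init (ds @ rs) = fires Init es" "set ds = past x"
     "set rs = set es - past x" "rs = filter (\<lambda>y. y \<notin> past x) es"
    by (rule run_split[OF r run_past[OF r x]]) (auto simp: past_def intro: evless_trans)
  moreover have "mk x = fires Init ds" using run_past_marking ds by (auto simp: run_append)
  ultimately show ?thesis using that by (auto simp: run_append)
qed

lemma mk_mono: 
  assumes "unf y" "x \<in> past y" shows "cle (mk x j) (mk y j)"
proof -
  obtain es where es: "run Init es" "set es = past y" "mk y = fires Init es"
    using assms(1) by (rule past_lin)
  obtain rs where "run (mk x) rs" "fires (mk x) rs = fires Init es"
    using assms(2) es(2) by (auto intro: run_past_split[OF es(1), of x])
  then show ?thesis using run_cle[of "mk x" rs j] es(3) by simp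
qed

text \<open>Of two events of component \<open>j\<close>, the later one consumes the current
  \<open>j\<close>-condition, which lies at or above the output that the earlier one left
  there.\<close>

lemma run_line_total:
  assumes "run Init es" "x \<in> set es" "y \<in> set es" "snd (evlab x) j \<noteq> None" "snd (evlab y) j \<noteq> None"
  shows "x = y \<or> evless x y \<or> evless y x"
proof -
  have later: "evless a b"
    if es: "es = as @ a # bs @ b # cs" and "snd (evlab a) j \<noteq> None" "snd (evlab b) j \<noteq> None" for a b as bs cs
  proof -
    have r: "run (fire a (fires Init as)) bs" "enabled (fires (fire a (fires Init as)) bs) b" "enabled (fires Init as) a"
      using assms(1) by (auto simp: es run_append)
    have "cle (Out a j) (fires (fire a (fires Init as)) bs j)"
      using run_cle[OF r(1), of j] that by (simp add: fire_simps)
    then have "cdev (Out a j) b" using that enabled_evin[OF r(2)] by (auto simp: cdev_iff cle_def)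
    moreover have "evcd a (Out a j)" using that enabled_parts[OF r(3)] by (auto simp: evcd_iff)
    ultimately show ?thesis by (rule evcd_cdev[rotated])
  qed
  obtain as bs where es: "es = as @ x # bs" using assms(2) by (meson split_list)
  then consider "y \<in> set as" | "y = x" | "y \<in> set bs" using assms(3) by auto
  then show ?thesis
  proof cases
    case 1
    then obtain p q where "as = p @ y # q" by (meson split_list)
    then show ?thesis using es later[of p y q x bs] assms by auto
  next
    case 3
    then obtain p q where "bs = p @ y # q" by (meson split_list)
    then show ?thesis using es later[of as x p y q] assms by auto
  qed simp
qed

lemma run_evco:
  assumes r: "run Init es" and "x \<in> set es" "y \<in> set es" shows "\<not> evconflict x y"
proof
  assume "evconflict x y"
  then obtain b e1 e2 where e: "e1 \<noteq> e2" "b \<in> set (evin e1)" "b \<in> set (evin e2)"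
    "e1 \<in> past x" "e2 \<in> past y" unfolding evconflict_def past_def by blast
  then have "e1 \<in> set es" "e2 \<in> set es" using run_past[OF r] assms by blast+
  then show False using run_no_conflict[OF r] e by blast
qed

subsection \<open>The sequence of interface events below a condition\<close>

text \<open>The interface events below an \<open>i\<close>-condition form a sequence that the
  condition, being a term, determines by itself. Two runs that reach the same
  \<open>i\<close>-condition thus have the same interface events in the same order, however their
  other events are arranged.\<close>

inductive ichain :: "('s,'a) cd \<Rightarrow> ('s,'a) ev list \<Rightarrow> bool" where
  "ichain (Init i) []"
| "ichain (inp i e) zs \<Longrightarrow> ichain (Out e i) (zs @ [e])"

lemma ichain_unique: "ichain b zs \<Longrightarrow> ichain b zs' \<Longrightarrow> zs = zs'"
proof (induction arbitrary: zs' rule: ichain.induct)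
  case 1
  then show ?case by (auto elim: ichain.cases)
next
  case (2 e zs)
  from 2(3) obtain zs'' where "zs' = zs'' @ [e]" "ichain (inp i e) zs''" by (auto elim: ichain.cases)
  then show ?case using 2(2) by simp
qed

lemma run_ichain: "run Init es \<Longrightarrow> ichain (fires Init es i) (filter (iev i) es)"
proof (induction es rule: rev_induct)
  case Nil
  then show ?case by (simp add: ichain.intros)
next
  case (snoc e es)
  then have r: "run Init es" and en: "enabled (fires Init es) e" by (auto simp: run_append)
  have IH: "ichain (fires Init es i) (filter (iev i) es)" using snoc r by blast
  have u: "unf e" using snoc.prems by (auto simp: unf_def)
  show ?case
  proof (cases "iev i e")
    case True
    then have "fires Init es i \<in> set (evin e)" using enabled_evin[OF en] by (simp add: iev_def)
    then have "inp i e = fires Init es i" using unf_evin(3)[OF u] fires_cidx[of Init] by simp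
    then have "ichain (Out e i) (filter (iev i) es @ [e])" using IH ichain.intros(2)[of e] by simp
    moreover have "fires Init (es @ [e]) i = Out e i" using True by (simp add: iev_def fire_simps)
    ultimately show ?thesis using True by simp
  next
    case False
    moreover have "fires Init (es @ [e]) i = fires Init es i"
      using False by (cases "snd (evlab e) i") (auto simp: iev_def fire_simps)
    ultimately show ?thesis using IH by simp
  qed
qed

lemma run_same_final_ifilter:
  assumes "run Init xs" "run Init ys" "fires Init xs i = fires Init ys i"
  shows "filter (iev i) xs = filter (iev i) ys"
  by (rule ichain_unique[OF run_ichain[OF assms(1)]]) (simp add: assms(3) run_ichain[OF assms(2)])

lemma run_same_set_length:
  assumes "run Init xs" "run Init ys" "set xs = set ys"
  shows "length xs = length ys" "filter (iev i) xs = filter (iev i) ys"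
proof -
  show "length xs = length ys"
    using distinct_card[OF run_distinct[OF assms(1)]] distinct_card[OF run_distinct[OF assms(2)]] assms(3)
    by simp
  show "filter (iev i) xs = filter (iev i) ys"
    by (rule run_same_final_ifilter[OF assms(1,2)]) (simp add: run_same_set[OF assms])
qed

lemma fires_no_iev: "filter (iev i) es = [] \<Longrightarrow> fires m es i = m i"
proof (induction es arbitrary: m)
  case (Cons e es)
  then have "\<not> iev i e" "filter (iev i) es = []" by (auto split: if_splits)
  moreover then have "fire e m i = m i" by (simp add: fire_def iev_def)
  ultimately show ?case using Cons.IH by simp
qed simp

subsection \<open>Invariants of the algorithm\<close>

definition wfev :: "('s,'a) ev \<Rightarrow> bool" where
  "wfev e \<longleftrightarrow> is_gtrans A n (evlab e) \<and> map cidx (evin e) = parts (evlab e)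
     \<and> (\<forall>b\<in>set (evin e). clab A b = fst (the (snd (evlab e) (cidx b))))"

text \<open>A condition in the range of \<open>m\<close> is found at its own index, so a mere
  inclusion of sets already recovers the ordered input list.\<close>

lemma enabledI:
  assumes m: "\<And>j. cidx (m j) = j" and e: "wfev e" "set (evin e) \<subseteq> range m"
  shows "enabled m e"
proof -
  have *: "m (cidx b) = b" if "b \<in> set (evin e)" for b using that e m by auto
  have p: "parts (evlab e) = map cidx (evin e)" and gt: "is_gtrans A n (evlab e)"
    using e by (auto simp: wfev_def)
  have "fst tr = clab A (m j)" if tr: "snd (evlab e) j = Some tr" for j tr
  proof -
    have "j \<in> cidx ` set (evin e)"
      using set_parts[OF gt] tr unfolding p by auto
    then have "m j \<in> set (evin e)" "cidx (m j) = j" using * m by auto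
    then show ?thesis using e(1) tr by (auto simp: wfev_def)
  qed
  moreover have "evin e = map m (parts (evlab e))"
    unfolding p by (simp add: map_idI *)
  ultimately show ?thesis using gt unfolding enabled_def by blast
qed

lemma enabled_evin_less:
  assumes "enabled m e" shows "set (evin e) \<subseteq> m ` {..<n}"
proof -
  have "{j. snd (evlab e) j \<noteq> None} \<subseteq> {..<n}"
    using gtrans_less[of "evlab e"] assms unfolding enabled_def by blast
  then show ?thesis unfolding enabled_evin[OF assms] by blast
qed

lemma enabled_wfev:
  assumes m: "\<And>j. cidx (m j) = j" and e: "enabled m e"
  shows "wfev e"
  using e m by (auto simp: wfev_def enabled_def set_parts o_def)

lemma unf_wfev:
  assumes "unf x" shows "wfev x"
proof -
  obtain as bs where "run Init (as @ x # bs)"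
    using assms unfolding unf_def by (metis split_list)
  then have "enabled (fires Init as) x" by (simp add: run_append)
  then show ?thesis by (rule enabled_wfev[rotated]) (simp add: fires_cidx)
qed

lemma fire_image:
  assumes m: "\<And>j. cidx (m j) = j" and e: "enabled m e"
  shows "fire e m ` {..<n} = m ` {..<n} - set (evin e) \<union> set (evout e)"
proof -
  let ?P = "{j. snd (evlab e) j \<noteq> None}"
  have gt: "is_gtrans A n (evlab e)" using e by (simp add: enabled_def)
  have P: "?P \<subseteq> {..<n}" using gtrans_less[OF gt] by blast
  have inj: "inj m" using m by (metis injI)
  have "{..<n} = ({..<n} - ?P) \<union> ?P" using P by blast
  then have "fire e m ` {..<n} = fire e m ` ({..<n} - ?P) \<union> fire e m ` ?P"
    by (metis image_Un)
  also have "fire e m ` ({..<n} - ?P) = m ` ({..<n} - ?P)"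
    by (rule image_cong) (auto simp: fire_def)
  also have "fire e m ` ?P = Out e ` ?P"
    by (rule image_cong) (auto simp: fire_def)
  finally show ?thesis
    by (simp only: enabled_evin[OF e] set_evout[OF gt] image_set_diff[OF inj])
qed

section \<open>Reachable markings and possible extensions as runs\<close>

lemma reach_run:
  assumes "Mk \<in> reach n N" "\<And>e. e \<in> N \<Longrightarrow> wfev e"
  shows "\<exists>es. run Init es \<and> set es \<subseteq> N \<and> Mk = fires Init es ` {..<n}"
  using assms(1)
proof (induction rule: reach.induct)
  case reach_init
  show ?case by (rule exI[of _ "[]"]) (auto simp: init_conds_def)
next
  case (reach_fire Mk e)
  then obtain es where es: "run Init es" "set es \<subseteq> N" "Mk = fires Init es ` {..<n}" by blast
  have m: "cidx (fires Init es j) = j" for j by (simp add: fires_cidx)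
  have en: "enabled (fires Init es) e"
    using reach_fire es by (intro enabledI) (auto simp: m assms(2))
  then show ?case
    using es reach_fire fire_image[OF m en]
    by (intro exI[of _ "es @ [e]"]) (simp add: run_append)
qed

lemma run_reach: "run Init es \<Longrightarrow> set es \<subseteq> N \<Longrightarrow> fires Init es ` {..<n} \<in> reach n N"
proof (induction es rule: rev_induct)
  case Nil
  have "(init_conds n :: ('s,'a) cd set) = Init ` {..<n}" by (auto simp: init_conds_def)
  then show ?case using reach.reach_init[of n N] by simp
next
  case (snoc e es)
  then have en: "enabled (fires Init es) e" and IH: "fires Init es ` {..<n} \<in> reach n N"
    by (auto simp: run_append)
  have "set (evin e) \<subseteq> fires Init es ` {..<n}"
    by (rule enabled_evin_less[OF en])
  then show ?case
    using reach.reach_fire[OF IH, of e] fire_image[OF _ en] snoc.prems by (simp add: fires_cidx)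
qed

lemma pext_run:
  assumes "pext A n N e" "\<And>x. x \<in> N \<Longrightarrow> unf x"
  obtains es where "run Init (es @ [e])" "set es \<subseteq> N"
proof -
  obtain Mk where Mk: "Mk \<in> reach n N" "set (evin e) \<subseteq> Mk" using assms by (auto simp: pext_def)
  obtain es where es: "run Init es" "set es \<subseteq> N" "Mk = fires Init es ` {..<n}"
    using reach_run[OF Mk(1)] assms(2) unf_wfev by blast
  have "enabled (fires Init es) e"
  proof (rule enabledI)
    show "wfev e" using assms by (auto simp: pext_def wfev_def)
  qed (use Mk es fires_cidx in auto)
  then show ?thesis using that es by (simp add: run_append)
qed

lemma run_pext:
  assumes "run Init (es @ [e])" "set es \<subseteq> N" "e \<notin> N"
  shows "pext A n N e"
proof -
  have r: "run Init es" and en: "enabled (fires Init es) e" using assms by (auto simp: run_append)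
  have "wfev e" by (rule enabled_wfev[OF _ en]) (simp add: fires_cidx)
  moreover have "fires Init es ` {..<n} \<in> reach n N" by (rule run_reach[OF r assms(2)])
  moreover have "set (evin e) \<subseteq> fires Init es ` {..<n}"
    by (rule enabled_evin_less[OF en])
  ultimately show ?thesis using assms(3) unfolding pext_def wfev_def by blast
qed

text \<open>Each cut-off needs a companion outside \<open>co\<close>, because the algorithm does not
  continue behind cut-offs. Injectivity of \<open>St\<close> on the other interface events bounds
  their number. Candidacy refers to the current \<open>N\<close> and \<open>co\<close>, as
  candidates can be freed.\<close>

definition alg_inv :: "('s,'a) astate \<Rightarrow> bool" where
  "alg_inv X \<longleftrightarrow> (case X of (N, co, coc, cp) \<Rightarrow>
     finite N \<and> (\<forall>x\<in>N. unf x \<and> past x \<subseteq> N) \<and> co \<subseteq> N \<and> coc \<subseteq> N \<and> (\<forall>e\<in>co. iev i e)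
     \<and> (\<forall>e\<in>coc. is_cand A n i N co e) \<and> (\<forall>x\<in>N. \<forall>e\<in>co \<union> coc. \<not> evless e x)
     \<and> (\<forall>e\<in>co. \<exists>e'\<in>N - co. iev i e' \<and> St A n e = St A n e' \<and> (e, e') \<in> cp)
     \<and> (\<forall>e e'. (e, e') \<in> cp \<longrightarrow> e \<in> N \<and> e' \<in> N \<and> iev i e \<and> iev i e' \<and> St A n e = St A n e')
     \<and> inj_on (St A n) {x \<in> N. iev i x \<and> x \<notin> co})"

lemma is_cand_mono:
  assumes "is_cand A n i N co e" "N \<subseteq> N'" "\<And>x. Con i N' co' x = Con i N co x"
  shows "is_cand A n i N' co' e"
  using assms unfolding is_cand_def by blast

lemma inv_init: "alg_inv alg_init"
  by (simp add: alg_inv_def alg_init_def)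

lemma inv_step:
  assumes "alg_inv (N, co, coc, cp)" "alg_step A n i (N, co, coc, cp) (N', co', coc', cp')"
  shows "alg_inv (N', co', coc', cp')"
proof -
  note I = assms(1)[unfolded alg_inv_def prod.case]
  from assms(2) obtain e where
    e: "pext A n N e" "\<forall>e'\<in>co \<union> coc. \<not> evless e' e" "N' = insert e N" and
    upd: "if is_cutoff A n i N e
        then co' = insert e co \<and> coc' = coc
             \<and> cp' = cp \<union> {(e, e') | e'. e' \<in> N \<and> iev i e' \<and> St A n e = St A n e'}
        else co' = co \<and> cp' = cp \<and>
          (if is_cand A n i N co e then coc' = insert e coc
           else coc' = coc - {ec \<in> coc. \<not> is_cand A n i (insert e N) co ec})"
    unfolding alg_step_def prod.case by blast
  have new: "e \<notin> N" using e(1) by (simp add: pext_def)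
  have unfN: "\<And>x. x \<in> N \<Longrightarrow> unf x" and pastN: "\<And>x. x \<in> N \<Longrightarrow> past x \<subseteq> N"
    and coN: "co \<subseteq> N" "coc \<subseteq> N" using I by blast+
  obtain es where es: "run Init (es @ [e])" "set es \<subseteq> N" by (rule pext_run[OF e(1) unfN])
  have unfe: "unf e" using es by (auto simp: unf_def)
  have paste: "past e \<subseteq> N'" using run_past[OF es(1), of e] es(2) e(3) by auto
  have below: "\<not> evless e x" if "x \<in> N'" for x
    using that pastN new evless_irrefl e(3) by (auto simp: past_def)
  have b1: "finite N'" "\<forall>x\<in>N'. unf x \<and> past x \<subseteq> N'" using I e(3) unfe paste by auto
  have b2: "\<forall>x\<in>N'. \<forall>e'\<in>insert e (co \<union> coc). \<not> evless e' x"
    using I e below by auto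
  \<comment> \<open>\<open>Con\<close> counts non-cut-off interface events only, so it changes at
    most when such an event is added. All other additions leave existing candidates intact.\<close>
  have Con_eq: "Con i N' co' x = Con i N co x" if "is_cutoff A n i N e \<or> \<not> iev i e" for x
  proof -
    have "e \<in> co' \<or> \<not> iev i e" "co' - {e} = co - {e}"
      using that upd by (auto split: if_splits)
    then show ?thesis using new coN unfolding Con_def e(3) by blast
  qed
  show ?thesis
  proof (cases "is_cutoff A n i N e")
    case True
    then have u: "co' = insert e co" "coc' = coc"
      "cp' = cp \<union> {(e, e') | e'. e' \<in> N \<and> iev i e' \<and> St A n e = St A n e'}"
      using upd by auto
    have ie: "iev i e" using True by (simp add: is_cutoff_def)
    have cand: "\<forall>x\<in>coc'. is_cand A n i N' co' x"
      using I is_cand_mono[of N co _ N' co'] Con_eq True e(3) u by blast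
    obtain e1 where e1: "e1 \<in> N" "iev i e1" "St A n e = St A n e1"
      using True by (auto simp: is_cutoff_def)
    \<comment> \<open>The companion \<open>e1\<close> may itself be a cut-off. Its own companion
      outside \<open>co\<close> has the same global state and, lying in \<open>N\<close> already, is
      recorded for \<open>e\<close> as well.\<close>
    have "\<exists>e2\<in>N - co. iev i e2 \<and> St A n e = St A n e2"
    proof (cases "e1 \<in> co")
      case False
      then show ?thesis using e1 by blast
    next
      case True
      then obtain e2 where "e2 \<in> N - co" "iev i e2" "St A n e1 = St A n e2" using I by blast
      then show ?thesis using e1 by auto
    qed
    then have comp: "\<forall>x\<in>co'. \<exists>e'\<in>N' - co'. iev i e' \<and> St A n x = St A n e' \<and> (x, e') \<in> cp'"
      using I new unfolding u e(3) by blast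
    have cpI: "\<forall>x x'. (x, x') \<in> cp' \<longrightarrow> x \<in> N' \<and> x' \<in> N' \<and> iev i x \<and> iev i x' \<and> St A n x = St A n x'"
      using I ie unfolding u e(3) by blast
    have "{x \<in> N'. iev i x \<and> x \<notin> co'} = {x \<in> N. iev i x \<and> x \<notin> co}"
      using new unfolding u e(3) by blast
    then have inj: "inj_on (St A n) {x \<in> N'. iev i x \<and> x \<notin> co'}" using I by simp
    have "co' \<subseteq> N'" "coc' \<subseteq> N'" "\<forall>x\<in>co'. iev i x" using I ie u e(3) by auto
    moreover have "\<forall>x\<in>N'. \<forall>e\<in>co' \<union> coc'. \<not> evless e x" using b2 u by auto
    ultimately show ?thesis unfolding alg_inv_def prod.case using b1 cand comp cpI inj by blast
  next
    case False
    then have u: "co' = co" "cp' = cp" and cc: "if is_cand A n i N co e then coc' = insert e coc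
           else coc' = coc - {ec \<in> coc. \<not> is_cand A n i N' co ec}"
      using upd e(3) by auto
    have cand: "\<forall>x\<in>coc'. is_cand A n i N' co' x"
    proof (cases "is_cand A n i N co e")
      case True
      then have "\<not> iev i e" by (simp add: is_cand_def)
      then have "is_cand A n i N' co' x" if "is_cand A n i N co x" for x
        using is_cand_mono[OF that] Con_eq e(3) by blast
      then show ?thesis using I True cc by auto
    next
      case False
      then show ?thesis using cc u by auto
    qed
    have sub: "coc' \<subseteq> insert e coc" using cc by (auto split: if_splits)
    have comp: "\<forall>x\<in>co'. \<exists>e'\<in>N' - co'. iev i e' \<and> St A n x = St A n e' \<and> (x, e') \<in> cp'"
      using I new unfolding u e(3) by blast
    have cpI: "\<forall>x x'. (x, x') \<in> cp' \<longrightarrow> x \<in> N' \<and> x' \<in> N' \<and> iev i x \<and> iev i x' \<and> St A n x = St A n x'"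
      using I unfolding u e(3) by blast
    have inj: "inj_on (St A n) {x \<in> N'. iev i x \<and> x \<notin> co'}"
    proof (cases "iev i e")
      case True
      have "St A n e \<notin> St A n ` {x \<in> N. iev i x \<and> x \<notin> co}"
        using False True by (auto simp: is_cutoff_def)
      moreover have "{x \<in> N'. iev i x \<and> x \<notin> co'} = insert e {x \<in> N. iev i x \<and> x \<notin> co}"
        using True new coN unfolding u e(3) by blast
      ultimately show ?thesis using I by auto
    next
      case False
      then have "{x \<in> N'. iev i x \<and> x \<notin> co'} = {x \<in> N. iev i x \<and> x \<notin> co}"
        unfolding u e(3) by blast
      then show ?thesis using I by simp
    qed
    have "co' \<subseteq> N'" "coc' \<subseteq> N'" "\<forall>x\<in>co'. iev i x" using I u e(3) sub by auto
    moreover have "\<forall>x\<in>N'. \<forall>e\<in>co' \<union> coc'. \<not> evless e x" using b2 u sub by blast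
    ultimately show ?thesis unfolding alg_inv_def prod.case using b1 cand comp cpI inj by blast
  qed
qed

lemma inv_reachable: "(alg_step A n i)\<^sup>*\<^sup>* alg_init X \<Longrightarrow> alg_inv X"
proof (induction rule: rtranclp_induct)
  case base
  show ?case by (rule inv_init)
next
  case (step X Y)
  then show ?case by (cases X, cases Y) (auto intro: inv_step)
qed

lemma alg_step_exists:
  assumes "pext A n N e" "\<forall>e'\<in>co \<union> coc. \<not> evless e' e"
  shows "\<exists>Y. alg_step A n i (N, co, coc, cp) Y"
proof -
  define Y where "Y = (if is_cutoff A n i N e
    then (insert e N, insert e co, coc, cp \<union> {(e, e') | e'. e' \<in> N \<and> iev i e' \<and> St A n e = St A n e'})
    else if is_cand A n i N co e then (insert e N, co, insert e coc, cp)
    else (insert e N, co, coc - {ec \<in> coc. \<not> is_cand A n i (insert e N) co ec}, cp))"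
  have "alg_step A n i (N, co, coc, cp) Y"
    unfolding alg_step_def Y_def using assms by auto
  then show ?thesis ..
qed

subsection \<open>Base conditions and segments\<close>

text \<open>Data of a condition from which segments start: the configuration already accounted for,
  and with \<open>stb\<close> the marking it reaches. The initial condition behaves like the output
  of an event with empty past.\<close>

definition preb :: "('s,'a) cd \<Rightarrow> ('s,'a) ev set" where
  "preb b = (case b of Init _ \<Rightarrow> {} | Out e _ \<Rightarrow> past e)"

definition stb :: "('s,'a) cd \<Rightarrow> ('s,'a) marking" where
  "stb b = (case b of Init _ \<Rightarrow> Init | Out e _ \<Rightarrow> mk e)"

definition ibase :: "('s,'a) cd \<Rightarrow> bool" where
  "ibase b \<longleftrightarrow> b = Init i \<or> (\<exists>e. b = Out e i \<and> unf e \<and> iev i e)"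

definition cw :: "('s,'a) ev set \<Rightarrow> real" where
  "cw D = (\<Sum>e\<in>D. gcost n c (evlab e))"

lemma ci_cw: "ci n c i e = cw (past e) - cw (preb (inp i e))"
  by (simp add: ci_def cw_def preb_def cpast_def split: cond.split)

lemma cw_list: "distinct es \<Longrightarrow> sum_list (map (gcost n c) (map evlab es)) = cw (set es)"
  by (simp add: cw_def sum_list_distinct_conv_sum_set o_def)

lemma cw_mono: "finite D' \<Longrightarrow> D \<subseteq> D' \<Longrightarrow> (\<And>e. e \<in> D' \<Longrightarrow> is_gtrans A n (evlab e)) \<Longrightarrow> cw D \<le> cw D'"
  unfolding cw_def by (rule sum_mono2) (auto simp: gcost_nonneg)

lemma run_cost_nonneg:
  assumes "set ts \<subseteq> {t. is_gtrans A n t}"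
  shows "0 \<le> sum_list (map (gcost n c) ts)"
  using assms by (intro sum_list_nonneg) (auto simp: gcost_nonneg)

lemma proj_run:
  assumes "run m es"
  shows "filter (\<lambda>a. a \<in> cAct (A i)) (map fst (map evlab es)) = map (\<lambda>e. fst (evlab e)) (filter (iev i) es)"
  using run_gtrans[OF assms]
  by (induction es) (auto simp: gtrans_i[symmetric] iev_def simp del: not_None_eq)

lemma stb_i: "ibase b \<Longrightarrow> stb b i = b"
  by (auto simp: ibase_def stb_def iev_def mk_own simp del: not_None_eq)

lemma base_split:
  assumes b: "ibase b" and r: "run Init es" and sub: "preb b \<subseteq> set es"
  obtains ds rs where "run Init (ds @ rs)" "set ds = preb b" "fires Init ds = stb b"
    "run (stb b) rs" "fires (stb b) rs = fires Init es" "set rs = set es - preb b"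
proof (cases b)
  case (Init j)
  then show ?thesis using that[of "[]" es] r by (auto simp: preb_def stb_def)
next
  case (Out e j)
  then have "e \<in> set es" using sub by (auto simp: preb_def)
  then show ?thesis
    using that Out by (auto simp: preb_def stb_def intro: run_past_split[OF r])
qed

lemma base_lin:
  assumes b: "ibase b"
  obtains ds where "run Init ds" "set ds = preb b" "fires Init ds = stb b"
proof (cases b)
  case (Init j)
  then show ?thesis using that[of "[]"] by (auto simp: preb_def stb_def)
next
  case (Out e j)
  then show ?thesis using b that by (auto simp: ibase_def preb_def stb_def elim: past_lin)
qed

lemma ibase_inp:
  assumes "unf x" "iev i x"
  shows "ibase (inp i x)" "preb (inp i x) \<subseteq> past x" "x \<notin> preb (inp i x)"
proof -
  obtain es where es: "run Init es" "x \<in> set es" using assms by (auto simp: unf_def)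
  have inx: "inp i x \<in> set (evin x)" using unf_evin(2)[OF assms(1)] assms(2) by (simp add: iev_def)
  have "i \<in> set (parts (evlab x))" using unf_parts[OF assms(1)] assms(2) by (simp add: iev_def)
  then have "i \<in> cidx ` set (evin x)" unfolding unf_evin(1)[OF assms(1), symmetric] by simp
  then have ci: "cidx (inp i x) = i" using unf_evin(3)[OF assms(1)] by auto
  from inx have "ibase (inp i x) \<and> preb (inp i x) \<subseteq> past x \<and> x \<notin> preb (inp i x)"
  proof (rule run_evin_cases[OF es])
    fix j assume "inp i x = Init j"
    then show ?thesis using ci by (auto simp: ibase_def preb_def)
  next
    fix y j assume y: "inp i x = Out y j" "y \<in> set es" "snd (evlab y) j \<noteq> None"
    then have j: "j = i" using ci by simp
    have u: "unf y" using es y by (auto simp: unf_def)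
    have "evless y x" using inx y u by (intro evless_direct[of y j]) (auto simp: unf_parts)
    then have "past y \<subseteq> past x" "x \<notin> past y"
      using evless_trans[of _ y x] evless_trans[of x y x] evless_irrefl by (auto simp: past_def)
    then show ?thesis using y u j unfolding ibase_def preb_def iev_def by auto
  qed
  then show "ibase (inp i x)" "preb (inp i x) \<subseteq> past x" "x \<notin> preb (inp i x)" by auto
qed

text \<open>Linearise \<open>past x\<close> with the past of its predecessor in front. The interface
  chains of the two end conditions differ by \<open>x\<close> alone, so the remainder has no other
  interface event.\<close>

lemma segment:
  assumes x: "unf x" "iev i x"
  obtains rs where "run (stb (inp i x)) rs" "fires (stb (inp i x)) rs = mk x"
    "filter (iev i) rs = [x]" "set rs = past x - preb (inp i x)" "distinct rs"
proof -
  obtain es where es: "run Init es" "set es = past x" "mk x = fires Init es"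
    using x(1) by (rule past_lin)
  obtain ds rs where ds: "run Init (ds @ rs)" "set ds = preb (inp i x)" "fires Init ds = stb (inp i x)"
    "run (stb (inp i x)) rs" "fires (stb (inp i x)) rs = fires Init es" "set rs = set es - preb (inp i x)"
    using base_split[OF ibase_inp(1)[OF x] es(1)] ibase_inp(2)[OF x] es(2) by metis
  have "ichain (inp i x) (filter (iev i) ds)"
    using run_ichain[of ds] ds stb_i[OF ibase_inp(1)[OF x]] by (simp add: run_append)
  then have "ichain (Out x i) (filter (iev i) ds @ [x])" by (rule ichain.intros)
  moreover have "ichain (Out x i) (filter (iev i) (ds @ rs))"
    using run_ichain[OF ds(1)] ds es mk_own[OF x(1)] x(2) by (simp add: iev_def del: not_None_eq)
  ultimately have "filter (iev i) rs = [x]" using ichain_unique by fastforce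
  moreover have "distinct rs" using run_distinct[OF ds(1)] by simp
  ultimately show ?thesis using that ds es by simp
qed

lemma St_gstate:
  assumes "St A n x = St A n y" shows "gstate (mk x) = gstate (mk y)"
  using assms by (auto simp: St_def gstate_def mk_def fun_eq_iff)

subsection \<open>The folding is a summary\<close>

context
  fixes N co coc :: "('s,'a) ev set" and cp :: "(('s,'a) ev \<times> ('s,'a) ev) set"
  assumes I: "alg_inv (N, co, coc, cp)"
begin

lemma invD:
  shows "finite N" "\<And>x. x \<in> N \<Longrightarrow> unf x" "\<And>x. x \<in> N \<Longrightarrow> past x \<subseteq> N" "co \<subseteq> N" "coc \<subseteq> N"
    "\<And>e. e \<in> co \<Longrightarrow> iev i e" "\<And>e. e \<in> coc \<Longrightarrow> is_cand A n i N co e"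
    "\<And>x e. x \<in> N \<Longrightarrow> e \<in> co \<union> coc \<Longrightarrow> \<not> evless e x"
    "\<And>e. e \<in> co \<Longrightarrow> \<exists>e'\<in>N - co. iev i e' \<and> St A n e = St A n e' \<and> (e, e') \<in> cp"
    "\<And>e e'. (e, e') \<in> cp \<Longrightarrow> e \<in> N \<and> e' \<in> N \<and> iev i e \<and> iev i e' \<and> St A n e = St A n e'"
  using I unfolding alg_inv_def prod.case by blast+

abbreviation "IC \<equiv> {b \<in> conds n N. cidx b = i}"

abbreviation "R \<equiv> foldeq n i N cp"

abbreviation "fstep \<equiv> \<lambda>s t. if R `` {inp i t} = s then Some (R `` {Out t i}) else None"

lemma Init_IC: "Init i \<in> IC"
  using i_less by (auto simp: conds_def init_conds_def)

lemma Out_IC: "e \<in> N \<Longrightarrow> iev i e \<Longrightarrow> Out e i \<in> IC"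
  using set_evout[OF unf_gtrans[OF invD(2)], of e] by (auto simp: conds_def iev_def)

lemma IC_cases:
  assumes "b \<in> IC" obtains "b = Init i" | e where "b = Out e i" "e \<in> N" "iev i e"
proof -
  from assms consider "b \<in> init_conds n" | e where "e \<in> N" "b \<in> set (evout e)"
    by (auto simp: conds_def)
  then show ?thesis
  proof cases
    case 1
    then show ?thesis using assms that by (auto simp: init_conds_def)
  next
    case 2
    then show ?thesis
      using assms that set_evout[OF unf_gtrans[OF invD(2)[OF 2(1)]]] by (auto simp: iev_def)
  qed
qed

lemma IC_ibase: "b \<in> IC \<Longrightarrow> ibase b"
  by (erule IC_cases) (auto simp: ibase_def invD(2))

lemma preb_IC:
  assumes "b \<in> IC" "x \<in> preb b"
  shows "\<exists>e. b = Out e i \<and> e \<in> N \<and> iev i e \<and> x \<in> past e"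
  using assms(1) by (cases rule: IC_cases) (use assms(2) in \<open>auto simp: preb_def\<close>)

lemma Mj_Out: "e \<in> N \<Longrightarrow> iev i e \<Longrightarrow> Mj n e i = Out e i"
  using mk_own[of e i] invD(2)[of e] i_less by (simp add: mk_def iev_def del: not_None_eq)

text \<open>An upper bound for the folding relation. As \<open>foldeq\<close> is an intersection, it
  suffices that this relation is one member of the family; then folded conditions have equal global
  states, and the intersection stays within \<open>IC \<times> IC\<close>.\<close>

definition same_state :: "('s,'a) cd rel" where
  "same_state = {(b, b') \<in> IC \<times> IC. b = b' \<or> (\<exists>e e'. b = Out e i \<and> b' = Out e' i \<and> St A n e = St A n e')}"

lemma same_state_in: "same_state \<in> {R. equiv IC R \<and> {(Mj n e i, Mj n e' i) | e e'. (e, e') \<in> cp} \<subseteq> R}"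
proof -
  have "equiv IC same_state"
  proof (rule equivI)
    show "same_state \<subseteq> IC \<times> IC" by (auto simp: same_state_def)
    show "refl_on IC same_state" by (auto simp: same_state_def refl_on_def)
    show "sym same_state"
    proof (rule symI)
      fix a b assume "(a, b) \<in> same_state"
      then show "(b, a) \<in> same_state" unfolding same_state_def by simp metis
    qed
    show "trans same_state" unfolding same_state_def trans_def by auto
  qed
  moreover have "{(Mj n e i, Mj n e' i) | e e'. (e, e') \<in> cp} \<subseteq> same_state"
  proof
    fix p assume "p \<in> {(Mj n e i, Mj n e' i) | e e'. (e, e') \<in> cp}"
    then obtain e e' where p: "p = (Mj n e i, Mj n e' i)" "(e, e') \<in> cp" by blast
    then have "e \<in> N" "e' \<in> N" "iev i e" "iev i e'" "St A n e = St A n e'" using invD(10) by blast+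
    then show "p \<in> same_state" using p Out_IC[of e] Out_IC[of e'] by (auto simp: same_state_def Mj_Out)
  qed
  ultimately show ?thesis by blast
qed

lemma foldeq_same_state: "R \<subseteq> same_state"
  unfolding foldeq_def using same_state_in by blast

lemma foldeq_equiv: "equiv IC R"
proof (rule equivI)
  show "R \<subseteq> IC \<times> IC" using foldeq_same_state by (auto simp: same_state_def)
  show "refl_on IC R" 
    unfolding foldeq_def refl_on_def by (auto dest!: equivE simp: equiv_def refl_on_def)
  show "sym R" unfolding foldeq_def
    by (rule symI) (auto dest: symD simp: equiv_def)
  show "trans R"
  proof (rule transI)
    fix x y z assume xy: "(x, y) \<in> R" and yz: "(y, z) \<in> R"
    have "(x, z) \<in> Q" if "equiv IC Q" "{(Mj n e i, Mj n e' i) | e e'. (e, e') \<in> cp} \<subseteq> Q" for Q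
    proof -
      have "(x, y) \<in> Q" "(y, z) \<in> Q" using xy yz that unfolding foldeq_def by blast+
      then show ?thesis using that(1) unfolding equiv_def by (meson transD)
    qed
    then show "(x, z) \<in> R" unfolding foldeq_def by blast
  qed
qed

lemma foldeq_cp:
  assumes "(e, e') \<in> cp" shows "R `` {Out e i} = R `` {Out e' i}"
proof -
  have "e \<in> N" "e' \<in> N" "iev i e" "iev i e'" using invD(10) assms by blast+
  then have "(Out e i, Out e' i) \<in> R"
    using assms unfolding foldeq_def by (auto simp: Mj_Out[symmetric])
  then show ?thesis using foldeq_equiv equiv_class_eq by fast
qed

text \<open>A path may leave a class at another representative than the one at which it entered.
  Both stand for the same global state, so the labels of the next segment can be executed there,
  although its events in general cannot. The weight \<open>ci\<close> is exactly the cost of the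
  segment.\<close>

lemma folded_sound:
  "set p \<subseteq> {e \<in> N. iev i e} \<Longrightarrow> b \<in> IC \<Longrightarrow> exec fstep (R `` {b}) p \<noteq> None
   \<Longrightarrow> \<exists>ts. set ts \<subseteq> {t. is_gtrans A n t} \<and> exec (gstep n) (gstate (stb b)) ts \<noteq> None
      \<and> filter (\<lambda>a. a \<in> cAct (A i)) (map fst ts) = map (\<lambda>e. fst (evlab e)) p
      \<and> sum_list (map (gcost n c) ts) = sum_list (map (ci n c i) p)"
proof (induction p arbitrary: b)
  case Nil
  then show ?case by (intro exI[of _ "[]"]) simp
next
  case (Cons x p)
  have x: "x \<in> N" "iev i x" "unf x" using Cons.prems invD by auto
  have ex: "exec fstep (R `` {Out x i}) p \<noteq> None" and eq: "R `` {inp i x} = R `` {b}"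
    using exec_Cons_SomeD[OF Cons.prems(3)] by (auto split: if_splits)
  have "(inp i x, b) \<in> R"
    using eq eq_equiv_class[OF _ foldeq_equiv Cons.prems(2)] by blast
  then have "(inp i x, b) \<in> same_state" using foldeq_same_state by blast
  then have start: "gstate (stb (inp i x)) = gstate (stb b)"
  proof -
    have "inp i x = b \<or> (\<exists>e e'. inp i x = Out e i \<and> b = Out e' i \<and> St A n e = St A n e')"
      using \<open>(inp i x, b) \<in> same_state\<close> by (simp add: same_state_def)
    then show ?thesis by (elim disjE exE) (auto simp: stb_def intro: St_gstate)
  qed
  obtain rs where rs: "run (stb (inp i x)) rs" "fires (stb (inp i x)) rs = mk x"
    "filter (iev i) rs = [x]" "set rs = past x - preb (inp i x)" "distinct rs"
    using x(3,2) by (rule segment)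
  obtain ts where ts: "set ts \<subseteq> {t. is_gtrans A n t}" "exec (gstep n) (gstate (mk x)) ts \<noteq> None"
      "filter (\<lambda>a. a \<in> cAct (A i)) (map fst ts) = map (\<lambda>e. fst (evlab e)) p"
      "sum_list (map (gcost n c) ts) = sum_list (map (ci n c i) p)"
    using Cons.IH[OF _ Out_IC[OF x(1,2)] ex] Cons.prems(1) by (auto simp: stb_def)
  let ?ts = "map evlab rs @ ts"
  have "set ?ts \<subseteq> {t. is_gtrans A n t}" using ts run_gtrans[OF rs(1)] by auto
  moreover have "exec (gstep n) (gstate (stb b)) ?ts \<noteq> None"
    using ts run_exec[OF rs(1)] rs(2) start by (simp add: exec_append)
  moreover have "filter (\<lambda>a. a \<in> cAct (A i)) (map fst ?ts) = map (\<lambda>e. fst (evlab e)) (x # p)"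
    using ts(3) proj_run[OF rs(1)] rs(3) by simp
  moreover have "sum_list (map (gcost n c) ?ts) = sum_list (map (ci n c i) (x # p))"
  proof -
    have "cw (set rs) = cw (past x) - cw (preb (inp i x))"
      unfolding rs(4) cw_def
      by (rule sum_diff) (use finite_past[OF x(3)] ibase_inp(2)[OF x(3,2)] in auto)
    then show ?thesis using cw_list[OF rs(5)] ts(4) by (simp add: ci_cw)
  qed
  ultimately show ?case by blast
qed

section \<open>Completeness of the folding\<close>

abbreviation "elab \<equiv> \<lambda>e :: ('s,'a) ev. fst (evlab e)"

text \<open>The prefix \<open>[ec]\<close> is replaced by \<open>[e']\<close>. The events of \<open>preb b\<close> outside \<open>[ec]\<close> can be kept
  literally: the order \<open>\<lless>\<close> together with the inclusion of the concurrent interface events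
  forces them to avoid the conditions in which the two markings differ.\<close>

lemma candidate_replace:
  assumes b: "b \<in> IC" "b \<notin> (\<lambda>e. Out e i) ` co" and es: "run Init es" "preb b \<subseteq> set es"
    and ec: "ec \<in> set es" "ec \<in> coc"
  obtains es' where "run Init es'" "preb b \<subseteq> set es'" "length es' < length es"
    "cw (set es') \<le> cw (set es)" "map elab (filter (iev i) es') = map elab (filter (iev i) es)"
proof -
  obtain e' where e': "e' \<in> N" "evll n e' ec" "St A n ec = St A n e'" "ip n i e' = ip n i ec"
    "Con i N co ec \<subseteq> Con i N co e'" using invD(7)[OF ec(2)] by (auto simp: is_cand_def)
  have u: "unf ec" "unf e'" using invD ec e' by blast+
  have less: "evless e' ec" using e'(2) by (simp add: evll_def)
  have ipeq: "mk e' i = mk ec i" using e'(4) i_less by (simp add: ip_def mk_def)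
  \<comment> \<open>The run is cut into \<open>past ec\<close>, the further events \<open>w\<close>
    needed for \<open>b\<close>, and a rest \<open>v\<close>. Only \<open>w\<close> has to be kept
    as events; \<open>v\<close> is replayed through its labels.\<close>
  let ?D = "past ec \<union> preb b"
  have "?D \<subseteq> set es" using run_past[OF es(1) ec(1)] es(2) by blast
  moreover have "y \<in> ?D" if "x \<in> ?D" "evless y x" for x y
  proof -
    have "y \<in> past x" using that by (simp add: past_def)
    then show ?thesis using that past_trans by (auto simp: preb_def split: cond.splits)
  qed
  ultimately obtain ds v where dv: "run Init (ds @ v)" "fires Init (ds @ v) = fires Init es"
    "set ds = ?D" "set v = set es - ?D"
    using run_split[OF es(1), of ?D] by metis
  have rds: "run Init ds" and rv: "run (fires Init ds) v" using dv by (auto simp: run_append)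
  obtain d w where dw: "run Init d" "set d = past ec" "fires Init d = mk ec"
    "run (mk ec) w" "fires (mk ec) w = fires Init ds" "run Init (d @ w)" "set w = set ds - past ec"
    using run_past_split[OF rds, of ec] dv(3) by (metis UnI1 past_refl)
  obtain d' where d': "run Init d'" "set d' = past e'" "mk e' = fires Init d'"
    using u(2) by (rule past_lin)
  have avoid: "mk ec j \<notin> set (evin x)" if x: "x \<in> set w" and j: "mk ec j \<noteq> mk e' j" for x j
  proof
    assume inx: "mk ec j \<in> set (evin x)"
    have "x \<in> preb b" "x \<notin> past ec" using x dw(7) dv(3) by auto
    then obtain ep where ep: "b = Out ep i" "ep \<in> N" "iev i ep" "x \<in> past ep"
      using preb_IC[OF b(1)] by blast
    have epco: "ep \<notin> co" using b(2) ep by auto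
    have "ep \<notin> past ec" using ep(4) \<open>x \<notin> past ec\<close> past_trans by blast
    then have "\<not> evless ep ec" by (simp add: past_def)
    moreover have "\<not> evless ec ep" using invD(8) ep ec by blast
    moreover have "ep \<in> set es" using es(2) ep(1) by (auto simp: preb_def)
    then have "\<not> evconflict ep ec" using run_evco[OF es(1)] ec by blast
    ultimately have "ep \<in> Con i N co ec" using ep epco by (simp add: Con_def evco_def)
    then have nless: "\<not> evless e' ep" using e'(5) by (auto simp: Con_def evco_def)
    have jn: "j < n" using j by (auto simp: mk_def split: if_splits)
    have "mk ec j \<notin> Mark n e'"
    proof
      assume "mk ec j \<in> Mark n e'"
      then obtain j' where "mk ec j = mk e' j'" by (auto simp: Mark_mk[OF u(2)])
      moreover from arg_cong[OF this, of cidx] have "j = j'" by (simp add: mk_cidx u)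
      ultimately show False using j by simp
    qed
    then have m1: "mk ec j \<in> Mark n ec - Mark n e'" using jn by (auto simp: Mark_mk[OF u(1)])
    \<comment> \<open>An output of \<open>e'\<close> consumed below \<open>ec\<close> is a lost
      condition, so \<open>evll\<close> puts it below the gained condition \<open>mk ec j\<close>.
      If \<open>x\<close> consumed the latter, \<open>e'\<close> would lie below \<open>x\<close>
      and hence below \<open>ep\<close>, against their concurrency.\<close>
    obtain z k where z: "k \<in> set (parts (evlab e'))" "Out e' k \<in> set (evin z)" "z \<in> past ec"
      using evless_first[OF less] by blast
    have k: "snd (evlab e') k \<noteq> None" using z(1) unf_parts[OF u(2)] by blast
    then have "k < n" "mk e' k = Out e' k"
      using gtrans_less[OF unf_gtrans[OF u(2)]] mk_own[OF u(2)] by blast+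
    then have "Out e' k \<in> Mark n e'" unfolding Mark_mk[OF u(2)] by (metis imageI lessThan_iff)
    moreover have "Out e' k \<notin> Mark n ec" using z by (auto simp: Mark_def)
    ultimately have "cdless (Out e' k) (mk ec j)" using e'(2) m1 by (auto simp: evll_def)
    moreover have "evcd e' (Out e' k)" unfolding evcd_iff using z(1) past_refl by blast
    ultimately have "evcd e' (mk ec j)" using evcd_cdless by blast
    then have "evless e' x" using inx evless_iff by blast
    then have "evless e' ep" using ep(4) evless_trans by (auto simp: past_def)
    then show False using nless by blast
  qed
  have "gstate (mk ec) = gstate (mk e')" by (rule St_gstate[OF e'(3)])
  from run_transfer[OF dw(4) avoid this]
  have w': "run (mk e') w" "gstate (fires (mk ec) w) = gstate (fires (mk e') w)" by auto
  have "exec (gstep n) (gstate (fires (mk e') w)) (map evlab v) \<noteq> None"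
    using run_exec[OF rv] w'(2) dw(5) by simp
  moreover have "set (map evlab v) \<subseteq> {t. is_gtrans A n t}" using run_gtrans[OF rv] by auto
  ultimately obtain v' where v': "run (fires (mk e') w) v'" "map evlab v' = map evlab v"
    using exec_run by blast
  define es' where "es' = d' @ w @ v'"
  have r': "run Init es'" using d' w' v' by (simp add: es'_def run_append)
  have rdw: "run Init (d' @ w)" using d' w' by (simp add: run_append)
  have sub: "preb b \<subseteq> set es'" using b(1)
  proof (cases rule: IC_cases)
    case 1
    then show ?thesis by (simp add: preb_def)
  next
    case (2 ep)
    have uep: "unf ep" using invD 2 by blast
    show ?thesis
    proof (cases "ep \<in> past ec")
      case True
      \<comment> \<open>Here equality of \<open>ip\<close> enters: the interface output of
        \<open>ep\<close> lies at or below the interface condition of \<open>ec\<close>, which is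
        also that of \<open>e'\<close>. Hence \<open>past e'\<close> contains
        \<open>past ep\<close>.\<close>
      have "snd (evlab ep) i \<noteq> None" using 2(3) by (simp add: iev_def)
      then have "cle (Out ep i) (mk e' i)" "evcd ep (Out ep i)"
        using mk_mono[OF u(1) True, of i] mk_own[OF uep] ipeq unf_parts[OF uep]
        by (auto simp: evcd_iff)
      then have "evcd ep (mk e' i)" using evcd_cdless by (auto simp: cle_def)
      then obtain x where x: "mk e' i = Out x i" "ep \<in> past x"
        using mk_cidx[OF u(2), of i] by (auto simp: evcd_iff)
      have "x \<in> past e'" using x(1) by (cases rule: mk_cases[OF u(2), of i]) auto
      then have "past ep \<subseteq> past e'" using x(2) past_trans by blast
      then show ?thesis using 2(1) d'(2) by (auto simp: preb_def es'_def)
    next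
      case False
      then have "ep \<in> set w" using dw(7) dv(3) 2(1) by (auto simp: preb_def)
      then have "past ep \<subseteq> set (d' @ w)" using run_past[OF rdw] by auto
      then show ?thesis using 2(1) by (auto simp: preb_def es'_def)
    qed
  qed
  have s1: "set (ds @ v) = set es" using dv \<open>?D \<subseteq> set es\<close> by auto
  have s2: "set (d @ w) = set ds" using dw dv by auto
  note e1 = run_same_set_length[OF dv(1) es(1) s1] and e2 = run_same_set_length[OF dw(6) rds s2]
  have psub: "past e' \<subset> past ec"
  proof -
    have "past e' \<subseteq> past ec" using less past_trans[of _ e' ec] by (auto simp: past_def)
    moreover have "ec \<notin> past e'" using less evless_irrefl evless_trans by (auto simp: past_def)
    ultimately show ?thesis using past_refl by blast
  qed
  have "length d' < length d"
    using psubset_card_mono[OF finite_past[OF u(1)] psub]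
      distinct_card[OF run_distinct[OF d'(1)]] distinct_card[OF run_distinct[OF dw(1)]] d' dw by simp
  moreover have "length v' = length v" using v'(2) by (metis length_map)
  ultimately have len: "length es' < length es" using e1(1) e2(1) by (simp add: es'_def)
  let ?cl = "\<lambda>xs :: ('s,'a) ev list. sum_list (map (gcost n c) (map evlab xs))"
  have cl: "cw (set xs) = ?cl xs" if "run Init xs" for xs
    using cw_list[OF run_distinct[OF that]] by simp
  have "?cl d' \<le> ?cl d"
    using cl[OF d'(1)] cl[OF dw(1)] d' dw cw_mono[of "past ec" "past e'"] psub finite_past[OF u(1)]
      unf_gtrans[OF unf_past[OF u(1)]] by auto
  moreover have "?cl v' = ?cl v" using v'(2) by metis
  moreover have "?cl es = ?cl d + ?cl w + ?cl v"
    using cl[OF es(1)] cl[OF dv(1)] cl[OF dw(6)] cl[OF rds] s1 s2 by simp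
  ultimately have cost: "cw (set es') \<le> cw (set es)"
    using cl[OF r'] cl[OF es(1)] by (simp add: es'_def)
  have "filter (iev i) d' = filter (iev i) d"
    using run_same_final_ifilter[OF d'(1) dw(1)] d' dw ipeq by metis
  moreover have "map elab (filter (iev i) v') = map elab (filter (iev i) v)"
    using proj_run[OF v'(1)] proj_run[OF rv] v'(2) by metis
  ultimately have "map elab (filter (iev i) es') = map elab (filter (iev i) es)"
    using e1(2) e2(2) by (simp add: es'_def flip: e1(2) e2(2))
  then show ?thesis using that r' sub len cost by blast
qed

text \<open>A minimal event of \<open>past x\<close> missing from \<open>N\<close> would be a
  possible extension, so at termination it lies above a cut-off or a candidate. Candidates are
  excluded by assumption. A cut-off strictly below \<open>x\<close> is an interface event, hence
  belongs to \<open>preb b\<close>; but the producer of \<open>b\<close> is in \<open>N\<close>, so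
  nothing below it is a cut-off, and it is none itself.\<close>

lemma next_event:
  assumes fin: "\<nexists>Y. alg_step A n i (N, co, coc, cp) Y"
    and b: "b \<in> IC" "b \<notin> (\<lambda>e. Out e i) ` co" and r: "run Init (es0 @ es1)"
    and es0: "set es0 = preb b" "fires Init es0 = stb b"
    and nc: "set (es0 @ es1) \<inter> coc = {}" and x: "filter (iev i) es1 = x # zs"
  shows "x \<in> N" "inp i x = b"
proof -
  obtain as bs where as: "es1 = as @ x # bs" "\<forall>y\<in>set as. \<not> iev i y" "iev i x"
    using x by (auto simp: filter_eq_Cons_iff)
  have r': "run Init (es0 @ as @ [x])" using r as by (simp add: run_append)
  have ux: "unf x" using r as by (auto simp: unf_def)
  have "fires Init (es0 @ as) i = b"
    using fires_no_iev[of as] as(2) es0(2) stb_i[OF IC_ibase[OF b(1)]] by simp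
  moreover have "enabled (fires Init (es0 @ as)) x" using r' by (simp add: run_append)
  ultimately have "b \<in> set (evin x)" using enabled_evin as(3) unfolding iev_def by blast
  moreover have "cidx b = i" using b by auto
  ultimately show "inp i x = b" using unf_evin(3)[OF ux] by blast
  have "y \<in> N" if "y \<in> past x" for y
    using that
  proof (induction y rule: measure_induct_rule[of size])
    case (less y)
    have uy: "unf y" using unf_past[OF ux less.prems] .
    have IH: "z \<in> N" if "evless z y" for z
    proof (rule less.IH)
      show "size z < size y" using that arcs_trancl_size unfolding evless_def by fastforce
      show "z \<in> past x" using that less.prems past_trans by (auto simp: past_def)
    qed
    show "y \<in> N"
    proof (rule ccontr)
      assume ny: "y \<notin> N"
      obtain ds where ds: "run Init ds" "set ds = past y" using uy by (rule past_lin)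
      obtain qs rs where q: "run Init (qs @ rs)" "set qs = past y - {y}" "set rs = set ds - (past y - {y})"
      proof (rule run_split[OF ds(1), of "past y - {y}"])
        show "past y - {y} \<subseteq> set ds" using ds by auto
        fix a z assume "a \<in> past y - {y}" "evless z a"
        then have "evless z y" using evless_trans by (auto simp: past_def)
        then show "z \<in> past y - {y}" using evless_irrefl by (auto simp: past_def)
      qed
      have "set rs = {y}" using q(3) ds(2) by auto
      moreover have "distinct rs" using run_distinct[OF q(1)] by simp
      ultimately have "rs = [y]" by (cases rs) (auto simp: subset_singleton_iff)
      then have "pext A n N y"
        using run_pext[of qs y N] q ny IH by (auto simp: past_def)
      moreover have "\<not> evless e y" if e: "e \<in> co \<union> coc" for e
      proof
        assume "evless e y"
        then have ex: "evless e x" using less.prems evless_trans by (auto simp: past_def)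
        then have ein: "e \<in> set (es0 @ as @ [x])" using run_evless_closed[OF r'] by auto
        then have "e \<in> co" using nc e as(1) by auto
        then have "iev i e" using invD by blast
        moreover have "e \<noteq> x" using ex evless_irrefl by blast
        ultimately have "e \<in> preb b" using ein as(2) es0 by auto
        then obtain ep where ep: "b = Out ep i" "ep \<in> N" "e \<in> past ep"
          using preb_IC[OF b(1)] by blast
        then have "e \<noteq> ep" using \<open>e \<in> co\<close> b(2) by blast
        then have "evless e ep" using ep by (simp add: past_def)
        then show False using invD(8) ep e by blast
      qed
      ultimately show False using fin alg_step_exists by blast
    qed
  qed
  then show "x \<in> N" by simp
qed

text \<open>Induction on the length of the history, because a replacement leaves the interface word
  unchanged and makes only the history shorter. The start avoids outputs of cut-offs, since nothing
  is explored behind them.\<close>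

lemma folded_complete:
  assumes fin: "\<nexists>Y. alg_step A n i (N, co, coc, cp) Y"
  shows "b \<in> IC \<Longrightarrow> b \<notin> (\<lambda>e. Out e i) ` co \<Longrightarrow> set ts \<subseteq> {t. is_gtrans A n t}
    \<Longrightarrow> exec (gstep n) (gstate (stb b)) ts \<noteq> None
    \<Longrightarrow> \<exists>p. set p \<subseteq> {e \<in> N. iev i e} \<and> exec fstep (R `` {b}) p \<noteq> None
      \<and> map elab p = filter (\<lambda>a. a \<in> cAct (A i)) (map fst ts)
      \<and> sum_list (map (ci n c i) p) \<le> sum_list (map (gcost n c) ts)"
proof (induction "length ts" arbitrary: b ts rule: less_induct)
  case less
  note b = less.prems(1,2)
  have ib: "ibase b" by (rule IC_ibase[OF b(1)])
  obtain es1 where es1: "run (stb b) es1" "map evlab es1 = ts"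
    using exec_run less.prems by blast
  obtain es0 where es0: "run Init es0" "set es0 = preb b" "fires Init es0 = stb b"
    using ib by (rule base_lin)
  define es where "es = es0 @ es1"
  have r: "run Init es" using es0 es1 by (simp add: es_def run_append)
  have dist: "distinct es0" "distinct es1" "set es0 \<inter> set es1 = {}"
    using run_distinct[OF r] by (auto simp: es_def)
  have proj: "filter (\<lambda>a. a \<in> cAct (A i)) (map fst ts) = map elab (filter (iev i) es1)"
    using proj_run[OF es1(1)] es1(2) by simp
  have lts: "length ts = length es1" using es1(2) by auto
  have cts: "sum_list (map (gcost n c) ts) = cw (set es1)"
    using cw_list[OF dist(2)] es1(2) by simp
  have cwes: "cw (set es) = cw (preb b) + cw (set es1)"
    unfolding es0(2)[symmetric] using dist(3) by (simp add: cw_def es_def sum.union_disjoint)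
  show ?case
  proof (cases "set es \<inter> coc = {}")
    case False
    then obtain ec where ec: "ec \<in> set es" "ec \<in> coc" by blast
    obtain es' where es': "run Init es'" "preb b \<subseteq> set es'" "length es' < length es"
      "cw (set es') \<le> cw (set es)" "map elab (filter (iev i) es') = map elab (filter (iev i) es)"
      by (rule candidate_replace[OF b r _ ec]) (auto simp: es_def es0)
    \<comment> \<open>The shorter run contains \<open>preb b\<close> but need not begin with it;
      reordering turns it back into a history from \<open>stb b\<close>.\<close>
    obtain ds rs where ds: "run Init (ds @ rs)" "set ds = preb b" "fires Init ds = stb b"
      "run (stb b) rs" "fires (stb b) rs = fires Init es'" "set rs = set es' - preb b"
      using ib es'(1,2) by (rule base_split)
    have rds: "run Init ds" using ds by (simp add: run_append)
    have s: "set (ds @ rs) = set es'" using ds es' by auto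
    note e1 = run_same_set_length[OF ds(1) es'(1) s] and e2 = run_same_set_length[OF rds es0(1)]
    have "length ds = length es0" "filter (iev i) ds = filter (iev i) es0" using e2 ds es0 by auto
    then have len: "length (map evlab rs) < length ts"
      and pr: "map elab (filter (iev i) rs) = map elab (filter (iev i) es1)"
      using e1(1) es'(3,5) lts unfolding e1(2)[symmetric] by (auto simp: es_def)
    have dist': "distinct (ds @ rs)" by (rule run_distinct[OF ds(1)])
    have "cw (set es') = cw (preb b) + cw (set rs)"
      using dist' unfolding s[symmetric] ds(2)[symmetric] by (simp add: cw_def sum.union_disjoint)
    then have cost: "sum_list (map (gcost n c) (map evlab rs)) \<le> sum_list (map (gcost n c) ts)"
      using es'(4) cwes cts cw_list[of rs] dist' by simp
    have "set (map evlab rs) \<subseteq> {t. is_gtrans A n t}" using run_gtrans[OF ds(4)] by auto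
    moreover have "exec (gstep n) (gstate (stb b)) (map evlab rs) \<noteq> None"
      using run_exec[OF ds(4)] by simp
    ultimately obtain p where "set p \<subseteq> {e \<in> N. iev i e}" "exec fstep (R `` {b}) p \<noteq> None"
      "map elab p = filter (\<lambda>a. a \<in> cAct (A i)) (map fst (map evlab rs))"
      "sum_list (map (ci n c i) p) \<le> sum_list (map (gcost n c) (map evlab rs))"
      using less.hyps[OF len b] by blast
    then show ?thesis using proj_run[OF ds(4)] pr proj cost by (intro exI[of _ p]) simp
  next
    case nc: True
    show ?thesis
    proof (cases "filter (iev i) es1")
      case Nil
      then show ?thesis
        using proj run_cost_nonneg[OF less.prems(3)] by (intro exI[of _ "[]"]) simp
    next
      case (Cons x zs)
      have "x \<in> set (filter (iev i) es1)" unfolding Cons by simp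
      then have ix: "iev i x" and xes: "x \<in> set es1" by auto
      have x: "x \<in> N" "inp i x = b"
        using next_event[OF fin b _ es0(2,3) _ Cons] r nc by (auto simp: es_def)
      have ux: "unf x" using invD x by blast
      have xs: "x \<in> set es" using xes by (simp add: es_def)
      obtain ds rs where ds: "run Init ds" "set ds = past x" "fires Init ds = mk x"
        "run (mk x) rs" "fires (mk x) rs = fires Init es" "run Init (ds @ rs)" "set rs = set es - past x"
        using r xs by (rule run_past_split)
      have pre: "preb b \<subseteq> past x" "x \<notin> preb b" using ibase_inp[OF ux ix] x(2) by auto
      obtain y where y: "y \<in> N" "iev i y" "y \<notin> co" "St A n x = St A n y" "R `` {Out x i} = R `` {Out y i}"
      proof (cases "x \<in> co")
        case True
        then obtain y where "y \<in> N - co" "iev i y" "St A n x = St A n y" "(x, y) \<in> cp"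
          using invD(9) by blast
        then show ?thesis using that foldeq_cp by blast
      next
        case False
        then show ?thesis using that x ix by blast
      qed
      have seq: "set es1 = set es - preb b" using dist(3) es0(2) by (auto simp: es_def)
      have sub: "past x \<subseteq> set es" by (rule run_past[OF r xs])
      have "set rs \<subset> set es1" using pre xs seq ds(7) past_refl[of x] by blast
      then have "card (set rs) < card (set es1)" by (intro psubset_card_mono) auto
      moreover have dr: "distinct rs" using run_distinct[OF ds(6)] by simp
      ultimately have len: "length (map evlab rs) < length ts"
        using lts distinct_card[OF dr] distinct_card[OF dist(2)] by simp
      have "set es1 = set rs \<union> (past x - preb b)" "set rs \<inter> (past x - preb b) = {}"
        using seq ds(7) pre sub by auto
      then have "cw (set es1) = cw (set rs) + cw (past x - preb b)"
        unfolding cw_def using finite_past[OF ux] by (simp add: sum.union_disjoint)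
      moreover have "cw (past x - preb b) = ci n c i x"
        unfolding ci_cw x(2) cw_def by (rule sum_diff[OF finite_past[OF ux] pre(1)])
      ultimately have cost: "sum_list (map (gcost n c) ts) = ci n c i x + cw (set rs)"
        using cts by simp
      have "set (map evlab rs) \<subseteq> {t. is_gtrans A n t}" using run_gtrans[OF ds(4)] by auto
      moreover have "exec (gstep n) (gstate (stb (Out y i))) (map evlab rs) \<noteq> None"
        using run_exec[OF ds(4)] St_gstate[OF y(4)] by (simp add: stb_def)
      moreover have "Out y i \<notin> (\<lambda>e. Out e i) ` co" using y(3) by auto
      ultimately obtain p where p: "set p \<subseteq> {e \<in> N. iev i e}" "exec fstep (R `` {Out y i}) p \<noteq> None"
        "map elab p = filter (\<lambda>a. a \<in> cAct (A i)) (map fst (map evlab rs))"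
        "sum_list (map (ci n c i) p) \<le> sum_list (map (gcost n c) (map evlab rs))"
        using less.hyps[OF len Out_IC[OF y(1,2)]] by blast
      \<comment> \<open>Extracting \<open>past x\<close> permutes the events of \<open>es1\<close>.
        Comparing interface chains shows that \<open>x\<close> is the only interface event moved
        out, and that it was the first one.\<close>
      have "ichain b (filter (iev i) es0)"
        using run_ichain[OF es0(1)] es0(3) stb_i[OF ib] by simp
      then have "ichain (Out x i) (filter (iev i) es0 @ [x])"
        using ichain.intros(2)[of x] x(2) by simp
      moreover have "mk x i = Out x i" using mk_own[OF ux] ix unfolding iev_def by blast
      then have "ichain (Out x i) (filter (iev i) ds)"
        using run_ichain[OF ds(1)] ds(3) by simp
      ultimately have "filter (iev i) ds = filter (iev i) es0 @ [x]" using ichain_unique by blast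
      moreover have "set (ds @ rs) = set es" using ds sub by auto
      then have "filter (iev i) (ds @ rs) = filter (iev i) es"
        by (rule run_same_set_length(2)[OF ds(6) r])
      ultimately have "filter (iev i) es1 = x # filter (iev i) rs" by (simp add: es_def)
      then have "map elab (x # p) = filter (\<lambda>a. a \<in> cAct (A i)) (map fst ts)"
        using p(3) proj proj_run[OF ds(4)] by simp
      moreover have "exec fstep (R `` {b}) (x # p) \<noteq> None" using p(2) x(2) y(5) by simp
      moreover have "sum_list (map (ci n c i) (x # p)) \<le> sum_list (map (gcost n c) ts)"
        using cost p(4) cw_list[OF dr] by simp
      moreover have "set (x # p) \<subseteq> {e \<in> N. iev i e}" using p x ix by simp
      ultimately show ?thesis by blast
    qed
  qed
qed

text \<open>Every path has a history of equal weight and every history a path that is at most as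
  expensive, both with the same interface word, so the minima agree. What remains is that the
  minimum over paths is attained.\<close>

lemma summary:
  assumes fin: "\<nexists>Y. alg_step A n i (N, co, coc, cp) Y"
  shows "mlts_wtraces (folding (iproj n c i N) R) = wproj (cAct (A i)) (comp_wtraces A c n)"
proof -
  define FH where "FH p \<sigma> \<longleftrightarrow> is_hist {e \<in> N. iev i e} fstep (R `` {Init i}) p \<and> map elab p = \<sigma>" for p \<sigma>
  define GH where "GH ts \<longleftrightarrow> is_hist {t. is_gtrans A n t} (gstep n) (\<lambda>j. cInit (A j)) ts" for ts :: "('s,'a) gtr list"
  let ?pr = "filter (\<lambda>a. a \<in> cAct (A i))"
  let ?fw = "\<lambda>p. sum_list (map (ci n c i) p)" and ?gw = "\<lambda>ts. sum_list (map (gcost n c) ts)"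
  have L: "mlts_wtraces (folding (iproj n c i N) R) =
    {(\<sigma>, w). \<exists>p. FH p \<sigma> \<and> w = ?fw p \<and> (\<forall>p'. FH p' \<sigma> \<longrightarrow> w \<le> ?fw p')}"
    unfolding mlts_wtraces_def folding_def iproj_def wtraces_def FH_def by (simp cong: if_cong)
  have W: "comp_wtraces A c n =
    {(\<sigma>, w). \<exists>h. GH h \<and> map fst h = \<sigma> \<and> w = ?gw h \<and> (\<forall>h'. GH h' \<and> map fst h' = \<sigma> \<longrightarrow> w \<le> ?gw h')}"
    unfolding comp_wtraces_def wtraces_def GH_def by simp
  have g0: "gstate (stb (Init i)) = (\<lambda>j. cInit (A j))"
    by (simp add: gstate_def stb_def clab_def)
  have sound: "\<exists>h. GH h \<and> ?pr (map fst h) = \<sigma> \<and> ?gw h = ?fw p" if "FH p \<sigma>" for p \<sigma>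
    using folded_sound[OF _ Init_IC, of p] that unfolding FH_def GH_def is_hist_def g0 by blast
  have complete: "\<exists>p. FH p (?pr (map fst h)) \<and> ?fw p \<le> ?gw h" if "GH h" for h
    using folded_complete[OF fin Init_IC, of h] that unfolding FH_def GH_def is_hist_def g0 by blast
  have sub: "(\<sigma>, w) \<in> wproj (cAct (A i)) (comp_wtraces A c n)"
    if p: "FH p \<sigma>" "w = ?fw p" "\<forall>p'. FH p' \<sigma> \<longrightarrow> w \<le> ?fw p'" for p \<sigma> w
  proof -
    obtain h where h: "GH h" "?pr (map fst h) = \<sigma>" "?gw h = w" using sound p by blast
    have min: "w \<le> ?gw h'" if "GH h'" "?pr (map fst h') = \<sigma>" for h'
      using complete[OF that(1)] that(2) p(3) order_trans by blast
    have "(map fst h, w) \<in> comp_wtraces A c n" unfolding W using h min by auto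
    moreover have "w \<le> w''" if "(\<sigma>'', w'') \<in> comp_wtraces A c n" "?pr \<sigma>'' = \<sigma>" for \<sigma>'' w''
      using that min unfolding W by auto
    ultimately show ?thesis unfolding wproj_def using h(2) by blast
  qed
  show ?thesis
  proof (intro set_eqI iffI)
    fix z assume "z \<in> mlts_wtraces (folding (iproj n c i N) R)"
    then show "z \<in> wproj (cAct (A i)) (comp_wtraces A c n)" using sub unfolding L by auto
  next
    fix z assume "z \<in> wproj (cAct (A i)) (comp_wtraces A c n)"
    then obtain \<sigma> w \<sigma>' where z: "z = (\<sigma>, w)" "(\<sigma>', w) \<in> comp_wtraces A c n" "\<sigma> = ?pr \<sigma>'"
      and min: "\<And>\<sigma>'' w''. (\<sigma>'', w'') \<in> comp_wtraces A c n \<Longrightarrow> ?pr \<sigma>'' = \<sigma> \<Longrightarrow> w \<le> w''"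
      unfolding wproj_def by auto
    then obtain h where h: "GH h" "map fst h = \<sigma>'" "w = ?gw h" unfolding W by auto
    obtain p where p: "FH p \<sigma>" "?fw p \<le> w" using complete[OF h(1)] h z by blast
    \<comment> \<open>Each transition carries one visible label, so the word fixes the length of a
      path and only finitely many paths compete. Histories with this projection may have unbounded
      length.\<close>
    have "{p. FH p \<sigma>} \<subseteq> {p. set p \<subseteq> N \<and> length p = length \<sigma>}"
      unfolding FH_def is_hist_def by auto
    then have "finite {p. FH p \<sigma>}" using finite_lists_length_eq[OF invD(1)] finite_subset by blast
    then obtain p0 where p0: "FH p0 \<sigma>" "\<forall>p'. FH p' \<sigma> \<longrightarrow> ?fw p0 \<le> ?fw p'"
      using p(1) arg_min_if_finite[of "{p. FH p \<sigma>}" ?fw]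
      by (metis empty_iff mem_Collect_eq not_le_imp_less)
    have "(\<sigma>, ?fw p0) \<in> wproj (cAct (A i)) (comp_wtraces A c n)" using sub p0 by blast
    then have "w \<le> ?fw p0" using min unfolding wproj_def by auto
    then have "w = ?fw p0" using p0(2) p by (meson order_antisym order_trans)
    then show "z \<in> mlts_wtraces (folding (iproj n c i N) R)" unfolding L using z p0 by auto
  qed
qed

end

subsection \<open>Chains in the unfolding\<close>

lemma finite_gtrans: "finite {t. is_gtrans A n t}"
proof -
  let ?B = "insert None (Some ` (\<Union>j<n. cTr (A j)))"
  let ?F = "{h. \<forall>j. (j \<in> {..<n} \<longrightarrow> h j \<in> ?B) \<and> (j \<notin> {..<n} \<longrightarrow> h j = None)}"
  have fin: "finite (cTr (A j)) \<and> finite (cAct (A j))" if "j < n" for j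
    using wf[OF that] finite_subset[of "cTr (A j)" "cSt (A j) \<times> cSt (A j)"] by (simp add: wf_wclts_def)
  have "finite ?F" by (rule finite_set_of_finite_funs) (use fin in auto)
  moreover have "finite (\<Union>j<n. cAct (A j))" using fin by auto
  moreover have "{t. is_gtrans A n t} \<subseteq> (\<Union>j<n. cAct (A j)) \<times> ?F"
  proof
    fix t :: "('s,'a) gtr" assume "t \<in> {t. is_gtrans A n t}"
    then have t: "is_gtrans A n t" by simp
    obtain j tr where "snd t j = Some tr" using t unfolding is_gtrans_def by blast
    then have "j < n" "fst t \<in> cAct (A j)" using gtrans_tr(1,3)[OF t] by auto
    then have "fst t \<in> (\<Union>j<n. cAct (A j))" by blast
    moreover have "snd t j \<in> ?B" for j
    proof (cases "snd t j")
      case (Some tr)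
      then have "j < n" "tr \<in> cTr (A j)" using gtrans_tr(1,2)[OF t] by auto
      then show ?thesis using Some by blast
    qed simp
    moreover have "snd t j = None" if "j \<notin> {..<n}" for j using that gtrans_less[OF t, of j] by blast
    then have "snd t \<in> ?F" using \<open>\<And>j. snd t j \<in> ?B\<close> by blast
    ultimately show "t \<in> (\<Union>j<n. cAct (A j)) \<times> ?F" unfolding mem_Times_iff by blast
  qed
  ultimately show ?thesis using finite_subset by blast
qed

lemma unf_pred:
  assumes "unf x" "Out y j \<in> set (evin x)"
  shows "unf y" "evless y x" "j < n"
proof -
  obtain es where es: "run Init es" "x \<in> set es" using assms by (auto simp: unf_def)
  have p: "j \<in> set (parts (evlab y))" by (rule run_pred_parts[OF es assms(2)])
  then show "evless y x" using assms evless_direct by blast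
  show u: "unf y" using run_pred_closed[OF es assms(2)] es by (auto simp: unf_def)
  show "j < n" using p unf_parts[OF u] gtrans_less[OF unf_gtrans[OF u]] by blast
qed

text \<open>An event is determined by its label and at most \<open>n\<close> inputs, each initial or
  an output of an event of smaller depth. Both ingredients range over finite sets.\<close>

lemma finite_unf_depth: "finite {x. unf x \<and> edepth x = k}"
proof (induction k rule: less_induct)
  case (less k)
  let ?E = "\<Union>l<k. {x. unf x \<and> edepth x = l}"
  let ?C = "Init ` {..<n} \<union> (\<lambda>(e, j). Out e j) ` (?E \<times> {..<n})"
  have "finite ?C" using less by auto
  then have "finite ((\<lambda>(t, bs). Ev t bs) ` ({t. is_gtrans A n t} \<times> {bs. set bs \<subseteq> ?C \<and> length bs \<le> n}))"
    by (intro finite_imageI finite_SigmaI finite_gtrans finite_lists_length_le)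
  moreover have "{x. unf x \<and> edepth x = k} \<subseteq> 
    (\<lambda>(t, bs). Ev t bs) ` ({t. is_gtrans A n t} \<times> {bs. set bs \<subseteq> ?C \<and> length bs \<le> n})"
  proof
    fix x :: "('s,'a) ev" assume "x \<in> {x. unf x \<and> edepth x = k}"
    then have x: "unf x" "edepth x = k" by auto
    obtain es where es: "run Init es" "x \<in> set es" using x by (auto simp: unf_def)
    have "set (evin x) \<subseteq> ?C"
    proof
      fix b assume b: "b \<in> set (evin x)"
      show "b \<in> ?C"
      proof (rule run_evin_cases[OF es b])
        fix j assume "b = Init j" "j < n" then show ?thesis by blast
      next
        fix y j assume "b = Out y j"
        then have "unf y" "j < n" "edepth y < k" using unf_pred[OF x(1)] edepth_less b x(2) by blast+
        then show ?thesis using \<open>b = Out y j\<close> by force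
      qed
    qed
    moreover have "length (evin x) \<le> n"
    proof -
      have "length (evin x) = length (parts (evlab x))"
        using unf_evin(1)[OF x(1)] by (metis length_map)
      also have "\<dots> = card (set (parts (evlab x)))" by (rule distinct_card[symmetric]) (simp add: parts_def)
      also have "\<dots> \<le> card {..<n}"
        using unf_parts[OF x(1)] gtrans_less[OF unf_gtrans[OF x(1)]] by (intro card_mono) auto
      finally show ?thesis by simp
    qed
    moreover have "x = Ev (evlab x) (evin x)" by simp
    moreover have "is_gtrans A n (evlab x)" by (rule unf_gtrans[OF x(1)])
    ultimately show "x \<in> (\<lambda>(t, bs). Ev t bs) ` ({t. is_gtrans A n t} \<times> {bs. set bs \<subseteq> ?C \<and> length bs \<le> n})"
      by (intro image_eqI[of _ _ "(evlab x, evin x)"]) auto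
  qed
  ultimately show ?case using finite_subset by blast
qed

lemma infinite_chain:
  assumes inf: "infinite X" and X: "\<And>x. x \<in> X \<Longrightarrow> unf x \<and> past x \<subseteq> X"
  obtains g where "\<And>k. g k \<in> X" "\<And>k. evless (g k) (g (Suc k))"
proof -
  define p where "p x = (SOME y. (\<exists>j. Out y j \<in> set (evin x)) \<and> Suc (edepth y) = edepth x)" for x :: "('s,'a) ev"
  have p: "(\<exists>j. Out (p x) j \<in> set (evin x)) \<and> Suc (edepth (p x)) = edepth x" if "edepth x = Suc k" for x k
    unfolding p_def by (rule someI_ex) (use edepth_Suc[OF that] that in auto)
  have less: "evless (p x) x" if "x \<in> X" "edepth x = Suc k" for x k
    using p[OF that(2)] unf_pred X that(1) by blast
  have "finite {x \<in> X. edepth x = k}" for k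
    by (rule finite_subset[OF _ finite_unf_depth[of k]]) (use X in auto)
  moreover have "p x \<in> X \<and> edepth (p x) = k" if "x \<in> X" "edepth x = Suc k" for x k
    using p[OF that(2)] less[OF that] X[OF that(1)] that(2) by (auto simp: past_def)
  ultimately obtain g where g: "\<And>k. g k \<in> X"
      "\<And>k. p (g (Suc k)) = g k \<and> edepth (g (Suc k)) = Suc (edepth (g k))"
    by (rule koenig[OF inf, of edepth p]) blast+
  have "evless (g k) (g (Suc k))" for k using less[OF g(1), of "Suc k"] g(2)[of k] by simp
  then show ?thesis using that g(1) by blast
qed

section \<open>Information flow along an infinite causal chain\<close>

context
  fixes g :: "nat \<Rightarrow> ('s,'a) ev"
  assumes gu: "\<And>k. unf (g k)" and gS: "\<And>k. evless (g k) (g (Suc k))"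
begin

lemma chain_less: "k < l \<Longrightarrow> evless (g k) (g l)"
  by (induction rule: less_Suc_induct) (auto intro: gS elim: evless_trans)

lemma chain_past: "k \<le> l \<Longrightarrow> g k \<in> past (g l)"
  using chain_less[of k l] by (auto simp: past_def le_less)

lemma chain_mono: "k \<le> l \<Longrightarrow> cle (mk (g k) j) (mk (g l) j)"
  by (intro mk_mono gu chain_past)

definition moving :: "nat set" where
  "moving = {j. \<forall>k. \<exists>l>k. mk (g l) j \<noteq> mk (g k) j}"

lemma moving_less: "j \<in> moving \<Longrightarrow> j < n"
  by (rule ccontr) (auto simp: moving_def mk_def)

lemma finite_moving: "finite moving"
  using moving_less by (meson finite_lessThan finite_subset lessThan_iff subsetI)

text \<open>Otherwise some condition recurs infinitely often. Between two occurrences the component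
  has changed, and conditions only move up along the chain, so antisymmetry is violated.\<close>

lemma moving_infinite:
  assumes j: "j \<in> moving" and L: "infinite L" shows "infinite ((\<lambda>l. mk (g l) j) ` L)"
proof
  assume "finite ((\<lambda>l. mk (g l) j) ` L)"
  then obtain k where k: "k \<in> L" "infinite {l \<in> L. mk (g l) j = mk (g k) j}"
    using pigeonhole_infinite[OF L] by blast
  obtain l where l: "l > k" "mk (g l) j \<noteq> mk (g k) j" using j by (auto simp: moving_def)
  obtain k' where k': "k' \<ge> l" "mk (g k') j = mk (g k) j"
    using infinite_unbounded[OF k(2), of l] by blast
  have "cle (mk (g k) j) (mk (g l) j)" "cle (mk (g l) j) (mk (g k) j)"
    using chain_mono[of k l j] chain_mono[of l k' j] l k' by auto
  then show False using cle_antisym l by blast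
qed

lemma moving_eventually_less:
  assumes "j \<in> moving" shows "\<forall>\<^sub>F l in sequentially. cdless (mk (g k) j) (mk (g l) j)"
proof -
  obtain l0 where l0: "l0 > k" "mk (g l0) j \<noteq> mk (g k) j" using assms by (auto simp: moving_def)
  then have "cdless (mk (g k) j) (mk (g l0) j)" using chain_mono[of k l0 j] by (auto simp: cle_def)
  then have "cdless (mk (g k) j) (mk (g l) j)" if "l \<ge> l0" for l
    using chain_mono[OF that, of j] cdless_trans by (auto simp: cle_def)
  then show ?thesis by (auto simp: eventually_sequentially)
qed

lemma nonmoving_stable: "\<exists>k1. \<forall>j. j \<notin> moving \<longrightarrow> (\<forall>l\<ge>k1. mk (g l) j = mk (g k1) j)"
proof -
  have "\<forall>\<^sub>F k in sequentially. \<forall>l\<ge>k. mk (g l) j = mk (g k) j" if j: "j \<notin> moving" for j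
  proof -
    obtain k where k: "\<And>l. l > k \<Longrightarrow> mk (g l) j = mk (g k) j" using j by (auto simp: moving_def)
    then have "mk (g l) j = mk (g k) j" if "l \<ge> k" for l using that by (cases "l = k") auto
    then show ?thesis unfolding eventually_sequentially by (metis order_trans)
  qed
  then have "\<forall>\<^sub>F k in sequentially. \<forall>j\<in>{..<n} - moving. \<forall>l\<ge>k. mk (g l) j = mk (g k) j"
    by (intro eventually_ball_finite) auto
  then obtain k where k: "\<forall>j\<in>{..<n} - moving. \<forall>l\<ge>k. mk (g l) j = mk (g k) j"
    by (auto simp: eventually_sequentially)
  have "mk (g l) j = mk (g k) j" if "j \<notin> moving" "l \<ge> k" for j l
  proof (cases "j < n")
    case True
    then show ?thesis using k that by blast
  next
    case False
    then show ?thesis by (simp add: mk_def)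
  qed
  then show ?thesis by blast
qed

lemma finite_evcd: "finite {x. evcd x (mk (g k) j)}"
proof (rule mk_cases[OF gu[of k], of j])
  assume "mk (g k) j = Init j"
  then show ?thesis by (simp add: evcd_iff)
next
  fix y assume y: "mk (g k) j = Out y j" "y \<in> past (g k)"
  then have "{x. evcd x (mk (g k) j)} \<subseteq> past y" by (auto simp: evcd_iff)
  then show ?thesis using finite_past[OF unf_past[OF gu y(2)]] finite_subset by blast
qed

lemma evcd_Out: "unf x \<Longrightarrow> snd (evlab x) j \<noteq> None \<Longrightarrow> y \<in> past x \<Longrightarrow> evcd y (Out x j)"
  unfolding evcd_iff using unf_parts by blast

text \<open>Every moving component eventually learns about every event of the chain. Otherwise, among the
  last events of the offending components take the maximal one: it synchronises with a component that
  is stable or well-informed, hence there are only finitely many choices for it.\<close>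

lemma moving_feedback:
  assumes "j0 \<in> moving" shows "\<exists>l. evcd (g k) (mk (g l) j0)"
proof (rule ccontr)
  assume "\<nexists>l. evcd (g k) (mk (g l) j0)"
  define B where "B = {j \<in> moving. \<exists>k. \<forall>l. \<not> evcd (g k) (mk (g l) j)}"
  have j0: "j0 \<in> B" using assms \<open>\<nexists>l. _\<close> by (auto simp: B_def)
  have Bm: "B \<subseteq> moving" by (auto simp: B_def)
  have finB: "finite B" using finite_moving Bm finite_subset by blast
  have Bn: "j < n" if "j \<in> B" for j using that Bm moving_less by blast
  \<comment> \<open>Knowing a chain event implies knowing all earlier ones, so a component that
    misses one misses all later ones. This yields one index \<open>kb\<close> for the whole of
    \<open>B\<close>.\<close>
  have "\<forall>\<^sub>F k in sequentially. \<forall>l. \<not> evcd (g k) (mk (g l) j)" if "j \<in> B" for j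
  proof -
    obtain k0 where k0: "\<forall>l. \<not> evcd (g k0) (mk (g l) j)" using \<open>j \<in> B\<close> by (auto simp: B_def)
    have "\<not> evcd (g k) (mk (g l) j)" if "k \<ge> k0" for k l
      using k0 chain_past[OF that] evless_evcd by (auto simp: past_def)
    then show ?thesis by (auto simp: eventually_sequentially)
  qed
  then have "\<forall>\<^sub>F k in sequentially. \<forall>j\<in>B. \<forall>l. \<not> evcd (g k) (mk (g l) j)"
    using finB by (simp add: eventually_ball_finite)
  then obtain kb where kb: "\<And>j l. j \<in> B \<Longrightarrow> \<not> evcd (g kb) (mk (g l) j)"
    by (auto simp: eventually_sequentially)
  \<comment> \<open>From \<open>l1\<close> on, every component of \<open>B\<close> has moved, so its
    current condition is the output of an event.\<close>
  have "\<forall>\<^sub>F l in sequentially. \<forall>j\<in>B. cdless (mk (g 0) j) (mk (g l) j)"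
    using finB Bm moving_eventually_less[of _ 0] by (intro eventually_ball_finite) auto
  then obtain l1 where l1: "\<And>l j. l \<ge> l1 \<Longrightarrow> j \<in> B \<Longrightarrow> cdless (mk (g 0) j) (mk (g l) j)"
    by (auto simp: eventually_sequentially)
  define l2 where "l2 = max l1 kb"
  have key: "\<exists>j j' f. j \<in> B \<and> j' < n \<and> j' \<notin> B \<and> mk (g l) j = Out f j \<and> snd (evlab f) j \<noteq> None
      \<and> snd (evlab f) j' \<noteq> None \<and> f \<in> past (g l)" if l: "l \<ge> l2" for l
  proof -
    have "\<exists>f. mk (g l) j = Out f j \<and> f \<in> past (g l) \<and> snd (evlab f) j \<noteq> None" if "j \<in> B" for j
      using l1[of l j] that l by (cases rule: mk_cases[OF gu[of l], of j]) (auto simp: l2_def cdless_iff)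
    then obtain F where F: "\<And>j. j \<in> B \<Longrightarrow> mk (g l) j = Out (F j) j \<and> F j \<in> past (g l) \<and> snd (evlab (F j)) j \<noteq> None"
      by metis
    \<comment> \<open>Size grows along causality, so an \<open>F j\<close> of maximal size is
      causally maximal among these last events. It differs from \<open>g l\<close>, since otherwise
      \<open>j\<close> would know \<open>g kb\<close>; hence one of its outputs is consumed below
      \<open>g l\<close>. If the component of that output were in \<open>B\<close>, its last event
      would lie above \<open>F j\<close>.\<close>
    have "Max ((\<lambda>j. size (F j)) ` B) \<in> (\<lambda>j. size (F j)) ` B"
      by (rule Max_in) (use finB j0 in auto)
    then obtain j where j: "j \<in> B" and jmax: "size (F j) = Max ((\<lambda>j. size (F j)) ` B)" by auto
    have max: "size (F j') \<le> size (F j)" if "j' \<in> B" for j'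
      unfolding jmax using finB that by (intro Max_ge) auto
    let ?f = "F j"
    have f: "mk (g l) j = Out ?f j" "?f \<in> past (g l)" "snd (evlab ?f) j \<noteq> None" using F[OF j] by auto
    have uf: "unf ?f" using unf_past[OF gu f(2)] .
    have "?f \<noteq> g l"
    proof
      assume eq: "?f = g l"
      have "g kb \<in> past ?f" using chain_past[of kb l] l eq by (simp add: l2_def)
      then have "evcd (g kb) (mk (g l) j)" using evcd_Out[OF uf f(3)] f(1) by simp
      then show False using kb j by blast
    qed
    then have "evless ?f (g l)" using f(2) by (simp add: past_def)
    then obtain z j' where z: "j' \<in> set (parts (evlab ?f))" "Out ?f j' \<in> set (evin z)" "z \<in> past (g l)"
      using evless_first by blast
    have pj': "snd (evlab ?f) j' \<noteq> None" using z(1) unf_parts[OF uf] by blast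
    then have j'n: "j' < n" using gtrans_less[OF unf_gtrans[OF uf]] by blast
    have "Out ?f j' \<notin> Mark n (g l)" using z by (auto simp: Mark_def)
    then have ne: "mk (g l) j' \<noteq> Out ?f j'" using j'n unfolding Mark_mk[OF gu] by (metis imageI lessThan_iff)
    moreover have "cle (Out ?f j') (mk (g l) j')"
      using mk_mono[OF gu f(2), of j'] mk_own[OF uf pj'] by simp
    ultimately have cl: "cdless (Out ?f j') (mk (g l) j')" by (auto simp: cle_def)
    have "j' \<notin> B"
    proof
      assume j'B: "j' \<in> B"
      then have "cdev (Out ?f j') (F j')" using cl F[OF j'B] by (auto simp: cdless_iff)
      then have "evless ?f (F j')" using evcd_cdev[OF evcd_Out[OF uf pj' past_refl]] by blast
      then have "size ?f < size (F j')" using arcs_trancl_size unfolding evless_def by fastforce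
      then show False using max[OF j'B] by simp
    qed
    then show ?thesis using j j'n pj' f by blast
  qed
  then obtain J J' F where JF: "\<And>l. l \<ge> l2 \<Longrightarrow> J l \<in> B \<and> J' l < n \<and> J' l \<notin> B \<and> mk (g l) (J l) = Out (F l) (J l)
      \<and> snd (evlab (F l)) (J l) \<noteq> None \<and> snd (evlab (F l)) (J' l) \<noteq> None \<and> F l \<in> past (g l)"
    by metis
  have "(\<lambda>l. (J l, J' l)) ` {l2..} \<subseteq> {..<n} \<times> {..<n}" using JF Bn by auto
  then have "finite ((\<lambda>l. (J l, J' l)) ` {l2..})" using finite_subset by blast
  then obtain la where la: "la \<in> {l2..}" "infinite {l \<in> {l2..}. (J l, J' l) = (J la, J' la)}"
    using pigeonhole_infinite[OF infinite_Ici] by blast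
  define j j' L where "j = J la" and "j' = J' la" and "L = {l \<in> {l2..}. (J l, J' l) = (J la, J' la)}"
  have L: "infinite L" using la by (simp add: L_def)
  have F: "mk (g l) j = Out (F l) j" "snd (evlab (F l)) j \<noteq> None" "snd (evlab (F l)) j' \<noteq> None" "F l \<in> past (g l)"
    if "l \<in> L" for l
    using that JF[of l] by (auto simp: L_def j_def j'_def)
  have jB: "j \<in> B" and j'B: "j' \<notin> B" using JF[of la] la by (auto simp: j_def j'_def)
  have "\<exists>l0 S. finite S \<and> (\<forall>l\<in>L. l \<ge> l0 \<longrightarrow> F l \<in> S)"
  proof (cases "j' \<in> moving")
    case False
    obtain k1 where k1: "\<And>l. l \<ge> k1 \<Longrightarrow> mk (g l) j' = mk (g k1) j'" using nonmoving_stable False by blast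
    have "evcd (F l) (mk (g k1) j')" if l: "l \<in> L" "l \<ge> k1" for l
    proof -
      have u: "unf (F l)" using unf_past[OF gu F(4)[OF l(1)]] .
      have "cle (Out (F l) j') (mk (g l) j')"
        using mk_mono[OF gu F(4)[OF l(1)], of j'] mk_own[OF u F(3)[OF l(1)]] by simp
      then show ?thesis
        using evcd_Out[OF u F(3)[OF l(1)] past_refl] evcd_cdless k1[OF l(2)] by (auto simp: cle_def)
    qed
    then show ?thesis using finite_evcd by blast
  next
    case True
    \<comment> \<open>Component \<open>j'\<close> learns of \<open>g kb\<close> through an event
      \<open>y\<close>. The events \<open>F l\<close> lie on the same component line, and none is at
      or after \<open>y\<close>, as it would pass this knowledge on to \<open>j\<close>. So all of
      them are in the finite set \<open>past y\<close>.\<close>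
    then obtain l3 where l3: "evcd (g kb) (mk (g l3) j')" using j'B by (auto simp: B_def)
    then obtain y where y: "mk (g l3) j' = Out y j'" "y \<in> past (g l3)" "snd (evlab y) j' \<noteq> None" "g kb \<in> past y"
      by (cases rule: mk_cases[OF gu[of l3], of j']) (auto simp: evcd_iff)
    have "F l \<in> past y" if l: "l \<in> L" "l \<ge> l3" for l
    proof -
      have u: "unf (F l)" using unf_past[OF gu F(4)[OF l(1)]] .
      have yl: "y \<in> past (g l)" using y(2) chain_past[OF l(2)] past_trans by blast
      obtain es where es: "run Init es" "set es = past (g l)" using gu[of l] by (rule past_lin)
      have "y = F l \<or> evless y (F l) \<or> evless (F l) y"
        using run_line_total[OF es(1) _ _ y(3) F(3)[OF l(1)]] yl F(4)[OF l(1)] es(2) by blast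
      moreover have "y \<notin> past (F l)"
      proof
        assume "y \<in> past (F l)"
        then have "g kb \<in> past (F l)" using y(4) past_trans by blast
        then have "evcd (g kb) (mk (g l) j)" using evcd_Out[OF u F(2)[OF l(1)]] F(1)[OF l(1)] by simp
        then show False using kb jB by blast
      qed
      ultimately show ?thesis by (auto simp: past_def)
    qed
    then show ?thesis using finite_past[OF unf_past[OF gu y(2)]] by blast
  qed
  then obtain l0 S where S: "finite S" "\<And>l. l \<in> L \<Longrightarrow> l \<ge> l0 \<Longrightarrow> F l \<in> S" by blast
  have "(\<lambda>l. mk (g l) j) ` (L \<inter> {l0..}) \<subseteq> (\<lambda>f. Out f j) ` S"
    using S(2) F(1) by auto
  then have "finite ((\<lambda>l. mk (g l) j) ` (L \<inter> {l0..}))" using S(1) finite_subset by blast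
  moreover have "j \<in> moving" using jB Bm by blast
  ultimately show False using moving_infinite infinite_Int_atLeast[OF L] by blast
qed

text \<open>An intermediate event \<open>g k2\<close> separates the two cuts: by then each moving
  component has left its condition at \<open>k\<close>, and by \<open>l\<close> each of them has
  learned of \<open>g k2\<close>. Every lost condition is thus below \<open>g k2\<close> and every
  gained one above it, for all pairs of components at once. The colouring \<open>h\<close> is free,
  to carry any further finite data that must repeat.\<close>

lemma chain_repetition:
  fixes h :: "nat \<Rightarrow> 'c"
  assumes fi: "finite (range (\<lambda>k. mk (g k) i))" and fh: "finite (range h)"
  obtains k l where "k0 \<le> k" "k < l" "h k = h l" "evll n (g k) (g l)" "mk (g k) i = mk (g l) i"
proof -
  obtain k1 where k1: "\<And>j l. j \<notin> moving \<Longrightarrow> l \<ge> k1 \<Longrightarrow> mk (g l) j = mk (g k1) j"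
    using nonmoving_stable by blast
  have im: "i \<notin> moving" using moving_infinite[of i UNIV] fi by auto
  have "finite (h ` {max k0 k1..})" by (rule finite_subset[OF _ fh]) auto
  then obtain k where k: "k \<in> {max k0 k1..}" "infinite {l \<in> {max k0 k1..}. h l = h k}"
    using pigeonhole_infinite[OF infinite_Ici] by blast
  have "\<forall>\<^sub>F k2 in sequentially. \<forall>j\<in>moving. cdless (mk (g k) j) (mk (g k2) j)"
    using finite_moving moving_eventually_less by (simp add: eventually_ball_finite)
  then obtain k2 where k2: "\<And>j. j \<in> moving \<Longrightarrow> cdless (mk (g k) j) (mk (g k2) j)"
    by (auto simp: eventually_sequentially)
  have "\<forall>\<^sub>F l in sequentially. evcd (g k2) (mk (g l) j)" if j: "j \<in> moving" for j
  proof -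
    obtain l0 where l0: "evcd (g k2) (mk (g l0) j)" using moving_feedback[OF j] by blast
    have "evcd (g k2) (mk (g l) j)" if "l \<ge> l0" for l
      using chain_mono[OF that, of j] l0 evcd_cdless by (auto simp: cle_def)
    then show ?thesis by (auto simp: eventually_sequentially)
  qed
  then have "\<forall>\<^sub>F l in sequentially. (\<forall>j\<in>moving. evcd (g k2) (mk (g l) j)) \<and> l > k"
    using finite_moving eventually_gt_at_top[of k] by (simp add: eventually_ball_finite eventually_conj)
  then obtain l where l: "l \<in> {l \<in> {max k0 k1..}. h l = h k}"
      "(\<forall>j\<in>moving. evcd (g k2) (mk (g l) j)) \<and> l > k"
    by (rule infinite_sequentially[OF k(2)])
  have mov: "j \<in> moving" if "mk (g l) j \<noteq> mk (g k) j" for j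
  proof (rule ccontr)
    assume "j \<notin> moving"
    moreover have "k1 \<le> l" "k1 \<le> k" using k(1) l(1) by auto
    ultimately have "mk (g l) j = mk (g k1) j" "mk (g k) j = mk (g k1) j" by (blast intro: k1)+
    then show False using that by simp
  qed
  have "evll n (g k) (g l)"
    unfolding evll_def
  proof (intro conjI ballI)
    show "evless (g k) (g l)" using chain_less l by blast
    fix b b' assume b: "b \<in> Mark n (g l) - Mark n (g k)" and b': "b' \<in> Mark n (g k) - Mark n (g l)"
    obtain j where j: "j < n" "b = mk (g l) j" using b by (auto simp: Mark_mk gu)
    have "mk (g l) j \<noteq> mk (g k) j"
      using b j unfolding Mark_mk[OF gu] by (metis DiffD2 imageI lessThan_iff)
    then have jm: "j \<in> moving" by (rule mov)
    obtain j' where j': "j' < n" "b' = mk (g k) j'" using b' by (auto simp: Mark_mk gu)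
    have "mk (g l) j' \<noteq> mk (g k) j'"
      using b' j' unfolding Mark_mk[OF gu] by (metis DiffD2 imageI lessThan_iff)
    then have j'm: "j' \<in> moving" by (rule mov)
    obtain y where y: "mk (g k2) j' = Out y j'" "cdev b' y" "y \<in> past (g k2)"
      using k2[OF j'm] j'(2) by (cases rule: mk_cases[OF gu[of k2], of j']) (auto simp: cdless_iff)
    then have "cdev b' (g k2)" using cdev_evless by (auto simp: past_def)
    then show "cdless b' b" using cdev_evcd l(2) jm j(2) by blast
  qed
  moreover have "mk (g k) i = mk (g l) i" using mov[of i] im by metis
  ultimately show ?thesis using that[of k l] k(1) l by auto
qed

end

subsection \<open>Termination\<close>

lemma finite_St: "finite (St A n ` {x. unf x})"
proof -
  have fin: "finite (\<Union>j<n. cSt (A j))" using wf by (auto simp: wf_wclts_def)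
  have "clab A (mk x j) \<in> cSt (A j)" if u: "unf x" and j: "j < n" for x j
  proof (rule mk_cases[OF u, of j])
    assume "mk x j = Init j"
    then show ?thesis using wf[OF j] by (simp add: clab_def wf_wclts_def)
  next
    fix y assume y: "mk x j = Out y j" "y \<in> past x" "snd (evlab y) j \<noteq> None"
    then obtain tr where tr: "snd (evlab y) j = Some tr" by blast
    then have "tr \<in> cTr (A j)" using gtrans_tr unf_gtrans[OF unf_past[OF u y(2)]] by blast
    then show ?thesis using wf[OF j] y(1) tr by (auto simp: clab_def wf_wclts_def)
  qed
  then have "St A n ` {x. unf x} \<subseteq> {ss. set ss \<subseteq> (\<Union>j<n. cSt (A j)) \<and> length ss = n}"
    by (force simp: St_def mk_def)
  then show ?thesis using finite_lists_length_eq[OF fin] finite_subset by blast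
qed

lemma algorithm_terminates: "\<nexists>f. f 0 = alg_init \<and> (\<forall>k. alg_step A n i (f k) (f (Suc k)))"
proof
  assume "\<exists>f. f 0 = alg_init \<and> (\<forall>k. alg_step A n i (f k) (f (Suc k)))"
  then obtain f where f0: "f 0 = alg_init" and fS: "\<And>k. alg_step A n i (f k) (f (Suc k))" by blast
  define N where "N k = fst (f k)" for k
  define co where "co k = fst (snd (f k))" for k
  define coc where "coc k = fst (snd (snd (f k)))" for k
  define cp where "cp k = snd (snd (snd (f k)))" for k
  have fk: "f k = (N k, co k, coc k, cp k)" for k by (simp add: N_def co_def coc_def cp_def)
  have "(alg_step A n i)\<^sup>*\<^sup>* alg_init (f k)" for k
    by (induction k) (use f0 fS in \<open>auto intro: rtranclp.rtrancl_into_rtrancl\<close>)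
  then have I: "alg_inv (N k, co k, coc k, cp k)" for k using inv_reachable fk by metis
  note D = invD[OF I]
  define adds where "adds k e \<longleftrightarrow> pext A n (N k) e \<and> N (Suc k) = insert e (N k) \<and>
       (if is_cutoff A n i (N k) e then co (Suc k) = insert e (co k) \<and> coc (Suc k) = coc k
        else co (Suc k) = co k \<and>
          (if is_cand A n i (N k) (co k) e then coc (Suc k) = insert e (coc k)
           else coc (Suc k) = coc k - {ec \<in> coc k. \<not> is_cand A n i (insert e (N k)) (co k) ec}))" for k e
  have "\<exists>e. adds k e" for k
    using fS[of k] unfolding fk alg_step_def adds_def prod.case
    by (elim exE, intro exI) (auto split: if_splits)
  then obtain e where adds: "\<And>k. adds k (e k)" using choice[of adds] by blast
  have e: "\<And>k. pext A n (N k) (e k)" "\<And>k. N (Suc k) = insert (e k) (N k)"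
      "\<And>k. if is_cutoff A n i (N k) (e k) then co (Suc k) = insert (e k) (co k) \<and> coc (Suc k) = coc k
        else co (Suc k) = co k \<and>
          (if is_cand A n i (N k) (co k) (e k) then coc (Suc k) = insert (e k) (coc k)
           else coc (Suc k) = coc k - {ec \<in> coc k. \<not> is_cand A n i (insert (e k) (N k)) (co k) ec})"
    using adds unfolding adds_def by blast+
  have new: "e k \<notin> N k" for k using e(1)[of k] by (simp add: pext_def)
  have monoN: "mono N" using e(2) by (intro mono_iff_le_Suc[THEN iffD2]) auto
  have coS: "co (Suc k) \<subseteq> insert (e k) (co k)" "co k \<subseteq> co (Suc k)" for k
    using e(3)[of k] by (auto split: if_splits)
  have monoco: "mono co" using coS by (intro mono_iff_le_Suc[THEN iffD2]) auto
  define X CO K where "X = (\<Union>k. N k)" and "CO = (\<Union>k. co k)" and "K = {x \<in> X. iev i x \<and> x \<notin> CO}"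
  \<comment> \<open>An event can become a cut-off only at the step that adds it, so membership in
    \<open>CO\<close> is already visible at every stage that contains the event.\<close>
  have co_eq: "x \<in> co k" if x: "x \<in> CO" "x \<in> N k" for x k
  proof -
    obtain l where l: "x \<in> co l" using x(1) by (auto simp: CO_def)
    show ?thesis
    proof (cases "l \<le> k")
      case True
      then show ?thesis using monoD[OF monoco True] l by blast
    next
      case False
      then have "k \<le> l" by simp
      then show ?thesis using l
      proof (induction l rule: dec_induct)
        case (step m)
        have "x \<noteq> e m" using new[of m] monoD[OF monoN step.hyps(1)] x(2) by blast
        then show ?case using step coS(1)[of m] by blast
      qed
    qed
  qed
  have infX: "infinite X"
  proof
    assume fin: "finite X"
    have "finite (N k) \<and> card (N k) = k" for k
    proof (induction k)
      case 0
      then show ?case using f0 by (simp add: N_def alg_init_def)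
    next
      case (Suc k)
      then show ?case using new[of k] by (simp add: e(2))
    qed
    moreover have "card (N k) \<le> card X" for k using fin by (intro card_mono) (auto simp: X_def)
    ultimately show False by (metis Suc_n_not_le_n)
  qed
  have unfX: "unf x \<and> past x \<subseteq> X" if x: "x \<in> X" for x
  proof -
    obtain k where k: "x \<in> N k" using x by (auto simp: X_def)
    have "past x \<subseteq> X" using D(3)[OF k] by (auto simp: X_def)
    then show ?thesis using D(2)[OF k] by simp
  qed
  have maxco: "\<not> evless z x" if z: "z \<in> co l \<union> coc l" and x: "x \<in> N l" for z x l
    using D(8)[OF x z] .
  have inX: "\<exists>l\<ge>k. x \<in> N l" if x: "x \<in> X" for x k
  proof -
    obtain m where "x \<in> N m" using x by (auto simp: X_def)
    then have "x \<in> N (max k m)" using monoD[OF monoN, of m "max k m"] by auto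
    then show ?thesis by (meson max.cobounded1)
  qed
  have maxCO: "\<not> evless z x" if zx: "z \<in> CO" "x \<in> X" for z x
  proof -
    obtain k where k: "z \<in> co k" using zx by (auto simp: CO_def)
    obtain l where l: "l \<ge> k" "x \<in> N l" using inX[OF zx(2)] by blast
    then have "z \<in> co l" using k monoD[OF monoco l(1)] by blast
    then show ?thesis using maxco l by blast
  qed
  have finK: "finite K"
  proof -
    have "inj_on (St A n) K"
    proof (rule inj_onI)
      fix x y assume xy: "x \<in> K" "y \<in> K" "St A n x = St A n y"
      obtain k where k: "x \<in> N k" using xy by (auto simp: K_def X_def)
      obtain l where l: "l \<ge> k" "y \<in> N l" using inX xy by (auto simp: K_def)
      have "x \<in> {x \<in> N l. iev i x \<and> x \<notin> co l}" "y \<in> {x \<in> N l. iev i x \<and> x \<notin> co l}"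
        using k l xy monoD[OF monoN l(1)] by (auto simp: K_def CO_def)
      moreover have "inj_on (St A n) {x \<in> N l. iev i x \<and> x \<notin> co l}"
        using I[of l] unfolding alg_inv_def prod.case by blast
      ultimately show "x = y" using xy(3) by (meson inj_onD)
    qed
    moreover have "finite (St A n ` K)"
      by (rule finite_subset[OF _ finite_St]) (use unfX in \<open>auto simp: K_def\<close>)
    ultimately show ?thesis using finite_imageD by blast
  qed
  obtain T where T: "K \<subseteq> N T"
    using finite_subset_increasing_union[OF finK _ monoN] by (auto simp: K_def X_def)
  \<comment> \<open>From stage \<open>T\<close> on all of \<open>K\<close> is present, so
    \<open>Con\<close> no longer depends on the stage.\<close>
  define C where "C x = {z \<in> K. evco z x}" for x
  have Con: "Con i (N k) (co k) x = C x" if "k \<ge> T" for k x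
    using T monoD[OF monoN that] co_eq[of _ k] by (auto simp: Con_def C_def K_def X_def CO_def)
  have cand_max: "\<not> evless (e k) x" if k: "k \<ge> T" and cand: "is_cand A n i (N k) (co k) (e k)" and x: "x \<in> X" for k x
  proof -
    have in_coc: "e k \<in> coc l" if "Suc k \<le> l" for l
      using that
    proof (induction l rule: dec_induct)
      case base
      have "\<not> is_cutoff A n i (N k) (e k)" using cand by (auto simp: is_cand_def is_cutoff_def)
      then show ?case using e(3)[of k] cand by simp
    next
      case (step m)
      have cm: "is_cand A n i (N m) (co m) (e k)" using D(7) step by blast
      show ?case
      proof (cases "is_cutoff A n i (N m) (e m) \<or> is_cand A n i (N m) (co m) (e m)")
        case True
        then show ?thesis using e(3)[of m] step by (auto split: if_splits)
      next
        case False
        then have u: "co (Suc m) = co m" "coc (Suc m) = coc m - {ec \<in> coc m. \<not> is_cand A n i (N (Suc m)) (co m) ec}"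
          using e(3)[of m] by (auto simp: e(2))
        have "is_cand A n i (N (Suc m)) (co (Suc m)) (e k)"
          using cm by (rule is_cand_mono) (use Con[of m] Con[of "Suc m"] step k e(2)[of m] in auto)
        then show ?thesis using u step by simp
      qed
    qed
    obtain l where "l \<ge> Suc k" "x \<in> N l" using inX[OF x] by blast
    then show ?thesis using maxco in_coc by blast
  qed
  obtain g where g: "\<And>k. g k \<in> X" "\<And>k. evless (g k) (g (Suc k))"
    by (rule infinite_chain[OF infX unfX]) blast+
  have gu: "unf (g k)" for k using unfX g by blast
  have injg: "inj g"
  proof (rule linorder_injI)
    fix k l :: nat assume "k < l"
    then show "g k \<noteq> g l" using chain_less[of g k l, OF gu g(2)] evless_irrefl[of "g l"] by auto
  qed
  have "finite (g -` N T)" using finite_vimageI[OF D(1) injg] .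
  then obtain k0 where k0: "\<And>k. k \<ge> k0 \<Longrightarrow> g k \<notin> N T"
    unfolding finite_nat_set_iff_bounded by (metis not_le vimageI)
  \<comment> \<open>Every event in the past of \<open>g k\<close> lies strictly below
    \<open>g (Suc k)\<close>, and nothing lies above a cut-off.\<close>
  have notCO: "z \<notin> CO" if "z \<in> past (g k)" for z k
    using that maxCO[of z "g (Suc k)"] g evless_trans[of z "g k" "g (Suc k)"] by (auto simp: past_def)
  have fi: "finite (range (\<lambda>k. mk (g k) i))"
  proof -
    have "mk (g k) i \<in> insert (Init i) ((\<lambda>z. Out z i) ` K)" for k
    proof (rule mk_cases[OF gu, of k i])
      fix y assume y: "mk (g k) i = Out y i" "y \<in> past (g k)" "snd (evlab y) i \<noteq> None"
      then have "y \<in> K" using notCO unfX[OF g(1)[of k]] by (auto simp: K_def iev_def)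
      then show ?thesis using y by blast
    qed simp
    then have "range (\<lambda>k. mk (g k) i) \<subseteq> insert (Init i) ((\<lambda>z. Out z i) ` K)" by blast
    then show ?thesis using finK finite_subset by blast
  qed
  have fh: "finite (range (\<lambda>k. (St A n (g k), C (g k))))"
  proof -
    have "range (\<lambda>k. (St A n (g k), C (g k))) \<subseteq> St A n ` {x. unf x} \<times> Pow K"
      using gu by (auto simp: C_def)
    moreover have "finite (St A n ` {x. unf x} \<times> Pow K)" using finite_St finK by simp
    ultimately show ?thesis using finite_subset by blast
  qed
  obtain k l where kl: "k0 \<le> k" "k < l" "(St A n (g k), C (g k)) = (St A n (g l), C (g l))"
      "evll n (g k) (g l)" "mk (g k) i = mk (g l) i"
    by (rule chain_repetition[of g, OF gu g(2) fi fh])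
  have "g l \<notin> N T" using k0 kl by simp
  have "\<exists>m. g l \<in> N m" using g(1)[of l] by (simp add: X_def)
  \<comment> \<open>The first stage containing \<open>g l\<close> identifies the step
    \<open>q\<close> at which it was tested. This happens after \<open>T\<close>, with the stable
    \<open>Con\<close>, and its witness \<open>g k\<close> is already present because processes are
    causally closed.\<close>
  then obtain m where m: "g l \<in> N m" "\<And>m'. m' < m \<Longrightarrow> g l \<notin> N m'" using exists_least_iff[of "\<lambda>m. g l \<in> N m"] by blast
  have "m > T" using m(1) \<open>g l \<notin> N T\<close> monoD[OF monoN, of m T] by (meson in_mono not_le)
  then obtain q where q: "m = Suc q" "q \<ge> T" by (cases m) auto
  have eq: "g l = e q" using m(1) m(2)[of q] q(1) by (simp add: e(2))
  have nie: "\<not> iev i (g l)"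
  proof
    assume "iev i (g l)"
    then have "g l \<in> K" using notCO[of "g l" l] g(1) by (simp add: K_def)
    then show False using T \<open>g l \<notin> N T\<close> by blast
  qed
  have "g k \<in> past (g l)" using kl(4) by (simp add: evll_def past_def)
  moreover have "past (g l) \<subseteq> N (Suc q)" using D(3) m(1) q(1) by blast
  moreover have "g k \<noteq> g l" using kl(2) injg by (simp add: inj_eq)
  ultimately have "g k \<in> N q" using eq by (auto simp: e(2))
  moreover have "ip n i (g k) = ip n i (g l)" using kl(5) i_less by (simp add: ip_def mk_def)
  moreover have "Con i (N q) (co q) (g l) \<subseteq> Con i (N q) (co q) (g k)" using Con[OF q(2)] kl(3) by simp
  ultimately have "is_cand A n i (N q) (co q) (g l)"
    unfolding is_cand_def using nie kl(3,4) by (metis Pair_inject)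
  then have "\<not> evless (g l) (g (Suc l))" using cand_max[OF q(2)] eq g(1) by simp
  then show False using g(2) by blast
qed

end

theorem theorem4:
  fixes A :: "nat \<Rightarrow> ('s,'a) clts" and c :: "nat \<Rightarrow> 's \<times> 's \<Rightarrow> real"
    and n i :: nat
  assumes "i < n"
    and "\<forall>j<n. wf_wclts (A j) (c j)"
  shows "(\<nexists>f. f 0 = alg_init \<and> (\<forall>k. alg_step A n i (f k) (f (Suc k))))
    \<and> (\<forall>N co coc cp. (alg_step A n i)\<^sup>*\<^sup>* alg_init (N, co, coc, cp)
         \<and> (\<nexists>Y. alg_step A n i (N, co, coc, cp) Y)
         \<longrightarrow> mlts_wtraces (folding (iproj n c i N) (foldeq n i N cp))
             = wproj (cAct (A i)) (comp_wtraces A c n))"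
proof -
  interpret composition A c n i
    using assms by unfold_locales auto
  show ?thesis
    using algorithm_terminates summary inv_reachable by blast
qed

end
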